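(* Assume (H1), (H3) and (H6). Then the differential equation with piecewise constant argument \[ y'(t)=A(t)y(t)+B(t)y(\gamma^0(t))+f(t),\qquad t\in\mathbb{R}, \] has a unique almost periodic solution $y$. Moreover, \[ |y|_{\infty}\le K_3|f|_{\infty},\qquad K_3=\Big[\sqrt{q}\,K_0(1+|B|_\infty\theta)\frac{2K}{1-\rho}+1\Big]\sqrt{q}\,K_0\,\theta, \] where $\theta=\sup_{n\in\mathbb{Z}}(t_{n+1}-t_n)$ and $K_0=\exp(|A|_\infty\theta)$.
   Context: Let $q\in\mathbb{N}$. $|\cdot|$ denotes the Euclidean norm on every finite-dimensional space (for matrices, the Euclidean norm of the array of entries), and for $g:D\to E$, $|g|_\infty=\sup_{t\in D}|g(t)|$. Fix a real sequence $(t_n)_{n\in\mathbb{Z}}$ with $t_n<t_{n+1}$ and $t_n\to\pm\infty$ as $n\to\pm\infty$; put $t^{(k)}_n=t_{n+k}-t_n$, $J_n=[t_n,t_{n+1})$, and $\gamma^0(t)=t_n$ for $t\in J_n$. A solution of an equation $x'(t)=\tilde f(t,\dots)$ involving $\gamma^0$ means a function $x$ that is continuous on $\mathbb{R}$, differentiable except possibly at the points $t_n$ (where both one-sided derivatives exist), and satisfies the equation except possibly at the points $t_n$. A set $E\subseteq\mathbb{R}$ (or $\subseteq\mathbb{Z}$) is relatively dense if there is $l>0$ with $E\cap[m,m+l]\neq\emptyset$ for all $m\in\mathbb{R}$. For $\mathbb{A}\in\{\mathbb{R},\mathbb{Z}\}$, a continuous $g:\mathbb{A}\to E$ is almost periodic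 if for every $\varepsilon>0$ the set $\{\tau\in\mathbb{A}:|g(t+\tau)-g(t)|\le\varepsilon\ \forall t\in\mathbb{A}\}$ is relatively dense. Let $A,B:\mathbb{R}\to M_q(\mathbb{C})$ and $f:\mathbb{R}\to\mathbb{C}^q$ be locally integrable. Let $X$ be a fundamental matrix of $x'=A(t)x$ and $X(t,s)=X(t)X(s)^{-1}$. For $n\in\mathbb{Z}$, $t\in[t_n,t_{n+1}]$, let $\mathcal{J}_n(t)=I+\int_{t_n}^tX(t_n,u)B(u)\,du$, assumed throughout to be invertible for all such $n,t$; let $Z_n(t)=X(t,t_n)\mathcal{J}_n(t)$ and $H(n)=Z_n(t_{n+1})$. Hypotheses: (H1) $A$ and $B$ are almost periodic. (H2) For every $\varepsilon>0$ the set $\bigcap_{k\in\mathbb{N}}\{T\in\mathbb{Z}: |t^{(k)}_{T+n}-t^{(k)}_n|\le\varepsilon \ \forall n\in\mathbb{Z}\}$ is relatively dense. (H3) (H2) holds, and for every $\varepsilon>0$ the set $\{\tau\in\mathbb{R}: |f(t+\tau)-f(t)|\le\varepsilon\ \forall t\in\mathbb{R}\setminus\bigcup_{n}(t_n-\varepsilon,t_n+\varepsilon)\}$ is relatively dense, and there is $\delta_\varepsilon>0$ such that $|f(t'+\tau')-f(t')|\le\varepsilon$ whenever $|\tau'|\le\delta_\varepsilon$ and $t',t'+\tau'$ lie in a common interval $[t_n,t_{n+1}]$. (H6) Let $\Phi$ be a fundamental matrix of $\phi(n+1)=H(n)\phi(n)$. There are a projection $\Pi$ on $\mathbb{C}^q$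 and constants $K>0$, $0<\rho<1$ with $|\mathcal{G}(n,k)|\le K\rho^{|n-k|}$ for all $n,k\in\mathbb{Z}$, where $\mathcal{G}(n,k)=\Phi(n)\Pi\Phi(k+1)^{-1}$ if $n>k$ and $\mathcal{G}(n,k)=-\Phi(n)(I-\Pi)\Phi(k+1)^{-1}$ if $n\le k$. *)

theory Defs
  imports "HOL-Analysis.Analysis"
begin

text \<open>Vectors in C^q are complex^'q, matrices in M_q(C) are complex^'q^'q. The library
norm on complex^'q^'q is the Euclidean norm of the array of entries.\<close>

definition rel_dense :: "real set \<Rightarrow> bool" where
  "rel_dense E \<longleftrightarrow> (\<exists>l>0. \<forall>m::real. E \<inter> {m..m+l} \<noteq> {})"

definition rel_dense_int :: "int set \<Rightarrow> bool" where
  "rel_dense_int E \<longleftrightarrow> (\<exists>l>0. \<forall>m::real. \<exists>T\<in>E. m \<le> real_of_int T \<and> real_of_int T \<le> m + l)"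

definition almost_periodic :: "(real \<Rightarrow> 'a::real_normed_vector) \<Rightarrow> bool" where
  "almost_periodic g \<longleftrightarrow> continuous_on UNIV g \<and>
     (\<forall>\<epsilon>>0. rel_dense {\<tau>. \<forall>t. norm (g (t + \<tau>) - g t) \<le> \<epsilon>})"

definition admissible_seq :: "(int \<Rightarrow> real) \<Rightarrow> bool" where
  "admissible_seq ts \<longleftrightarrow> (\<forall>n. ts n < ts (n + 1)) \<and>
     filterlim ts at_top at_top \<and> filterlim ts at_bot at_bot"

definition gamma0 :: "(int \<Rightarrow> real) \<Rightarrow> real \<Rightarrow> real" where
  "gamma0 ts s = ts (THE n. ts n \<le> s \<and> s < ts (n + 1))"

definition tk :: "(int \<Rightarrow> real) \<Rightarrow> nat \<Rightarrow> int \<Rightarrow> real" where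
  "tk ts k n = ts (n + int k) - ts n"

definition H2 :: "(int \<Rightarrow> real) \<Rightarrow> bool" where
  "H2 ts \<longleftrightarrow> (\<forall>\<epsilon>>0. rel_dense_int
      (\<Inter>k\<in>{1..}. {T. \<forall>n. \<bar>tk ts k (T + n) - tk ts k n\<bar> \<le> \<epsilon>}))"

definition H3 :: "(int \<Rightarrow> real) \<Rightarrow> (real \<Rightarrow> 'a::real_normed_vector) \<Rightarrow> bool" where
  "H3 ts f \<longleftrightarrow> H2 ts \<and>
     (\<forall>\<epsilon>>0. rel_dense {\<tau>. \<forall>s. s \<notin> (\<Union>n. {ts n - \<epsilon> <..< ts n + \<epsilon>}) \<longrightarrow>
                               norm (f (s + \<tau>) - f s) \<le> \<epsilon>}
            \<and> (\<exists>\<delta>>0. \<forall>t' \<tau>'. \<bar>\<tau>'\<bar> \<le> \<delta> \<and>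
                 (\<exists>n. t' \<in> {ts n..ts (n + 1)} \<and> t' + \<tau>' \<in> {ts n..ts (n + 1)}) \<longrightarrow>
                 norm (f (t' + \<tau>') - f t') \<le> \<epsilon>))"

definition locally_integrable :: "(real \<Rightarrow> 'a::euclidean_space) \<Rightarrow> bool" where
  "locally_integrable g \<longleftrightarrow> (\<forall>a b. g absolutely_integrable_on {a..b})"

definition fundamental_matrix ::
  "(real \<Rightarrow> complex^'q^'q) \<Rightarrow> (real \<Rightarrow> complex^'q^'q::finite) \<Rightarrow> bool" where
  "fundamental_matrix A X \<longleftrightarrow> (\<forall>t. invertible (X t) \<and>
      (X has_vector_derivative (A t ** X t)) (at t))"

definition Xts :: "(real \<Rightarrow> complex^'q^'q) \<Rightarrow> real \<Rightarrow> real \<Rightarrow> complex^'q^'q::finite" where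
  "Xts X t s = X t ** matrix_inv (X s)"

definition Jn :: "(int \<Rightarrow> real) \<Rightarrow> (real \<Rightarrow> complex^'q^'q) \<Rightarrow> (real \<Rightarrow> complex^'q^'q)
                  \<Rightarrow> int \<Rightarrow> real \<Rightarrow> complex^'q^'q::finite" where
  "Jn ts X B n t = mat 1 + integral {ts n..t} (\<lambda>u. Xts X (ts n) u ** B u)"

definition Hmat :: "(int \<Rightarrow> real) \<Rightarrow> (real \<Rightarrow> complex^'q^'q) \<Rightarrow> (real \<Rightarrow> complex^'q^'q)
                  \<Rightarrow> int \<Rightarrow> complex^'q^'q::finite" where
  "Hmat ts X B n = Xts X (ts (n + 1)) (ts n) ** Jn ts X B n (ts (n + 1))"

definition green :: "(int \<Rightarrow> complex^'q^'q) \<Rightarrow> complex^'q^'q \<Rightarrow> int \<Rightarrow> int \<Rightarrow> complex^'q^'q::finite" where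
  "green Phi P n k = (if n > k then Phi n ** P ** matrix_inv (Phi (k + 1))
                      else - (Phi n ** (mat 1 - P) ** matrix_inv (Phi (k + 1))))"

definition H6 :: "(int \<Rightarrow> real) \<Rightarrow> (real \<Rightarrow> complex^'q^'q) \<Rightarrow> (real \<Rightarrow> complex^'q^'q)
    \<Rightarrow> (int \<Rightarrow> complex^'q^'q) \<Rightarrow> complex^'q^'q \<Rightarrow> real \<Rightarrow> real \<Rightarrow> bool" where
  "H6 ts X B Phi P K \<rho> \<longleftrightarrow>
     (\<forall>n. invertible (Phi n) \<and> Phi (n + 1) = Hmat ts X B n ** Phi n) \<and>
     P ** P = P \<and> K > 0 \<and> 0 < \<rho> \<and> \<rho> < 1 \<and>
     (\<forall>n k. norm (green Phi P n k) \<le> K * \<rho> ^ nat \<bar>n - k\<bar>)"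

definition is_solution :: "(int \<Rightarrow> real) \<Rightarrow> (real \<Rightarrow> complex^'q^'q) \<Rightarrow> (real \<Rightarrow> complex^'q^'q)
    \<Rightarrow> (real \<Rightarrow> complex^'q) \<Rightarrow> (real \<Rightarrow> complex^'q::finite) \<Rightarrow> bool" where
  "is_solution ts A B f y \<longleftrightarrow> continuous_on UNIV y \<and>
     (\<forall>n. (\<exists>d. (y has_vector_derivative d) (at_left (ts n))) \<and>
          (\<exists>d. (y has_vector_derivative d) (at_right (ts n)))) \<and>
     (\<forall>s. s \<notin> range ts \<longrightarrow>
        (y has_vector_derivative (A s *v y s + B s *v y (gamma0 ts s) + f s)) (at s))"

end

theory Submission
  imports Defs
begin

text \<open>On each interval between consecutive \<open>ts n\<close> the equation is linear with a constant forcing term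
  \<open>B(t) y(ts n)\<close>, so the values \<open>y(ts n)\<close> satisfy a difference equation with matrix \<open>Hmat\<close>. The
  exponential dichotomy of H6 and Gronwall's inequality yield an a priori bound: a bounded function
  that solves the equation up to an error whose integral over each interval is at most \<open>\<delta>\<close> has
  sup-norm at most a constant times \<open>\<delta>\<close>. Applied to a difference of two solutions it gives
  uniqueness, and applied to a solution it gives the stated estimate. Existence of a bounded solution
  \<open>y\<close> comes from the Green function. For a common almost period \<open>\<tau>\<close> of \<open>A\<close>, \<open>B\<close>, \<open>f\<close> and the
  sequence, \<open>y(t + \<tau>) - y(t)\<close> solves the homogeneous equation up to an error of small integral, so
  the same bound shows that \<open>y\<close> is almost periodic.\<close>

section \<open>Matrices acting on vectors and Gronwall estimates\<close>

text \<open>Two obstacles shape the proof. First, \<open>gamma0\<close> jumps at the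
  \<open>ts n\<close>, and translation by \<tau> moves the jumps to nearby but different places. The
  residual of a translated solution is therefore not uniformly small, so errors are measured by
  their integral over an interval, which is all that Gronwall's inequality needs. Second,
  \<open>A\<close>, \<open>B\<close>, \<open>f\<close> and the sequence each bring their own
  relatively dense set of almost periods, and such sets need not meet. Common almost periods are
  produced as differences, by a pigeonhole argument that leaves only a small mismatch; H3 fits in
  because it makes \<open>f\<close> almost periodic in the ordinary sense. Gronwall is applied to
  vectors and not to the matrix X(t,s), whose norm at t = s is sqrt q; the argument thus gives a
  bound free of sqrt q, and these factors are inserted only at the end.\<close>

lemma norm_matrix_vector_mult_le:
  fixes M :: "'a::real_normed_field^'n^'m"
  shows "norm (M *v x) \<le> norm M * norm x"
proof -
  have "norm ((M *v x) $ i) \<le> norm (M $ i) * norm x" for i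
  proof -
    have "norm ((M *v x) $ i) \<le> (\<Sum>j\<in>UNIV. norm (M $ i $ j) * norm (x $ j))"
      unfolding matrix_vector_mult_def by (simp add: norm_mult sum_norm_le)
    also have "\<dots> \<le> norm (M $ i) * norm x"
      using L2_set_mult_ineq[of "\<lambda>j. norm (M $ i $ j)" "\<lambda>j. norm (x $ j)" UNIV]
      by (simp add: norm_vec_def)
    finally show ?thesis .
  qed
  then have "norm (M *v x) \<le> L2_set (\<lambda>i. norm (M $ i) * norm x) UNIV"
    unfolding norm_vec_def[of "M *v x"] by (intro L2_set_mono) auto
  also have "\<dots> = norm M * norm x"
    by (simp add: norm_vec_def[of M] L2_set_left_distrib)
  finally show ?thesis .
qed

lemma bounded_bilinear_matrix_vector_mult:
  "bounded_bilinear ((*v) :: 'a::real_normed_field^'n^'m \<Rightarrow> 'a^'n \<Rightarrow> 'a^'m)"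
proof
  show "\<exists>K. \<forall>M x. norm ((M :: 'a^'n^'m) *v x) \<le> norm M * norm x * K"
    using norm_matrix_vector_mult_le by (metis mult.right_neutral)
qed (auto simp: matrix_vector_mult_def vec_eq_iff scaleR_sum_right algebra_simps sum.distrib)

lemmas continuous_on_matrix_vector_mult =
  bounded_bilinear.continuous_on[OF bounded_bilinear_matrix_vector_mult]

lemma bounded_linear_matrix_vector_mult_right:
  "bounded_linear (\<lambda>x. (M :: 'a::real_normed_field^'n^'m) *v x)"
  by (rule bounded_bilinear.bounded_linear_right[OF bounded_bilinear_matrix_vector_mult])

lemma bounded_linear_matrix_vector_mult_left:
  "bounded_linear (\<lambda>M. (M :: 'a::real_normed_field^'n^'m) *v x)"
  by (rule bounded_bilinear.bounded_linear_left[OF bounded_bilinear_matrix_vector_mult])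

lemma continuous_on_matrix_matrix_mult:
  fixes F :: "'t::topological_space \<Rightarrow> 'a::real_normed_field^'n^'m" and G :: "'t \<Rightarrow> 'a^'p^'n"
  assumes "continuous_on S F" "continuous_on S G"
  shows "continuous_on S (\<lambda>t. F t ** G t)"
  unfolding matrix_matrix_mult_def
  by (intro continuous_on_vec_lambda continuous_on_sum continuous_on_mult continuous_on_component
      assms)

lemma matrix_mult_matrix_inv:
  assumes "invertible M"
  shows "M ** matrix_inv M = mat 1" and "matrix_inv M ** M = mat 1"
  using someI_ex[OF assms[unfolded invertible_def]] unfolding matrix_inv_def by auto

lemma continuous_on_det:
  fixes F :: "'t::topological_space \<Rightarrow> 'a::real_normed_field^'n^'n"
  assumes "continuous_on S F"
  shows "continuous_on S (\<lambda>t. det (F t))"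
  unfolding det_def
  by (intro continuous_on_sum continuous_on_mult continuous_on_prod continuous_on_component
      continuous_on_const assms)

text \<open>By Cramer's rule the entries of the inverse are quotients of determinants, which are
  polynomial in the entries.\<close>

lemma continuous_on_matrix_inv:
  fixes F :: "'t::topological_space \<Rightarrow> 'a::real_normed_field^'n^'n"
  assumes "continuous_on S F" and inv: "\<And>t. t \<in> S \<Longrightarrow> invertible (F t)"
  shows "continuous_on S (\<lambda>t. matrix_inv (F t))"
proof -
  define C where "C t k j = det (\<chi> i l. if l = k then axis j 1 $ i else F t $ i $ l) / det (F t)"
    for t k j
  have "matrix_inv (F t) = (\<chi> k j. C t k j)" if "t \<in> S" for t
  proof -
    have "F t *v (matrix_inv (F t) *v axis j 1) = axis j 1" for j
      using inv[OF that] by (simp add: matrix_vector_mul_assoc matrix_mult_matrix_inv)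
    then have "matrix_inv (F t) *v axis j 1 = (\<chi> k. C t k j)" for j
      using cramer[of "F t"] inv[OF that] unfolding C_def by (simp add: invertible_det_nz)
    moreover have "matrix_inv (F t) $ k $ j = (matrix_inv (F t) *v axis j 1) $ k" for k j
      by (simp add: matrix_vector_mult_def axis_def if_distrib cong: if_cong)
    ultimately show ?thesis
      by (simp add: vec_eq_iff)
  qed
  moreover have "continuous_on S (\<lambda>t. \<chi> k j. C t k j)"
  proof (intro continuous_on_vec_lambda)
    fix k j
    have "continuous_on S (\<lambda>t. \<chi> i l. if l = k then axis j 1 $ i else F t $ i $ l)"
    proof (intro continuous_on_vec_lambda)
      show "continuous_on S (\<lambda>t. if l = k then axis j 1 $ i else F t $ i $ l)" for i l
        by (cases "l = k") (auto intro!: continuous_on_component assms)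
    qed
    then show "continuous_on S (\<lambda>t. C t k j)"
      unfolding C_def
      by (intro continuous_on_divide continuous_on_det assms)
        (use inv in \<open>auto simp: invertible_det_nz\<close>)
  qed
  ultimately show ?thesis
    by (simp cong: continuous_on_cong)
qed

section \<open>Gronwall inequalities\<close>

lemma gronwall_integral:
  fixes u :: "real \<Rightarrow> real"
  assumes "continuous_on {a..b} u" and "0 \<le> L" and t: "t \<in> {a..b}"
    and le: "\<And>s. s \<in> {a..b} \<Longrightarrow> u s \<le> c + integral {a..s} (\<lambda>r. L * u r)"
  shows "u t \<le> c * exp (L * (t - a))"
proof -
  \<comment> \<open>Integrating factor: the derivative of \<open>V\<close> at \<open>s\<close> is L
    exp(-L(s - a)) times the difference of \<open>u s\<close> and its assumed upper bound, hence
    nonpositive.\<close>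
  define V where "V s = (c + integral {a..s} (\<lambda>r. L * u r)) * exp (- L * (s - a))" for s
  have der: "(V has_real_derivative
      (L * u s * exp (- L * (s - a)) - L * (c + integral {a..s} (\<lambda>r. L * u r)) * exp (- L * (s - a))))
      (at s within {a..b})" if "s \<in> {a..b}" for s
  proof -
    have "((\<lambda>s. integral {a..s} (\<lambda>r. L * u r)) has_real_derivative L * u s) (at s within {a..b})"
      using that assms by (intro integral_has_real_derivative) (auto intro!: continuous_intros)
    then show ?thesis
      unfolding V_def
      by (auto intro!: derivative_eq_intros simp: algebra_simps simp del: integral_mult_right)
  qed
  have "V t \<le> V a"
  proof (rule DERIV_nonpos_imp_decreasing_open[of a t V])
    show "a \<le> t" using t by simp
    show "continuous_on {a..t} V"
      using t by (intro continuous_on_subset[of "{a..b}" V "{a..t}"] DERIV_continuous_on[OF der]) auto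
    fix x assume x: "a < x" "x < t"
    then have "x \<in> {a..b}" "at x within {a..b} = at x"
      using t by (auto intro!: at_within_interior)
    moreover have "L * u x * exp (- L * (x - a))
        \<le> L * (c + integral {a..x} (\<lambda>r. L * u r)) * exp (- L * (x - a))"
      using le[OF \<open>x \<in> {a..b}\<close>] \<open>0 \<le> L\<close> by (intro mult_right_mono mult_left_mono) auto
    ultimately show "\<exists>y. (V has_real_derivative y) (at x) \<and> y \<le> 0"
      using der[of x] by (metis diff_le_0_iff_le)
  qed
  then have "(c + integral {a..t} (\<lambda>r. L * u r)) * exp (- L * (t - a)) \<le> c"
    by (simp add: V_def)
  then have "(c + integral {a..t} (\<lambda>r. L * u r)) * exp (- L * (t - a)) * exp (L * (t - a))
      \<le> c * exp (L * (t - a))"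
    by (rule mult_right_mono) simp
  then have "c + integral {a..t} (\<lambda>r. L * u r) \<le> c * exp (L * (t - a))"
    by (simp add: mult.assoc flip: exp_add)
  then show ?thesis
    using le[OF t] by simp
qed

text \<open>The perturbation \<beta> enters only through its integral, so it may be large on short
  stretches. The finite set \<open>S\<close> admits corners of \<open>r\<close>. With
  \<open>L = 0\<close> this is a mean value inequality.\<close>

lemma gronwall_derivative:
  fixes r :: "real \<Rightarrow> 'a::banach"
  assumes cont: "continuous_on {a..b} r" and "finite S" and "0 \<le> L" and t: "t \<in> {a..b}"
    and der: "\<And>s. s \<in> {a<..<b} - S \<Longrightarrow> (r has_vector_derivative r' s) (at s)"
    and bound: "\<And>s. s \<in> {a<..<b} - S \<Longrightarrow> norm (r' s) \<le> L * norm (r s) + \<beta> s"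
    and \<beta>: "\<beta> integrable_on {a..b}" "\<And>s. s \<in> {a..b} \<Longrightarrow> 0 \<le> \<beta> s" "integral {a..b} \<beta> \<le> c"
  shows "norm (r t) \<le> (norm (r a) + c) * exp (L * (t - a))"
proof (rule gronwall_integral[of a b "\<lambda>s. norm (r s)"])
  fix s assume s: "s \<in> {a..b}"
  \<comment> \<open>Extending \<open>r'\<close> by 0 to the endpoints and to \<open>S\<close> makes
    the pointwise bound hold on the whole closed interval, its right-hand side being
    nonnegative.\<close>
  define g where "g x = (if x \<in> {a<..<b} - S then r' x else 0)" for x
  have sub: "{a..s} \<subseteq> {a..b}" using s by auto
  have "(g has_integral r s - r a) {a..s}"
    using s \<open>finite S\<close> der
    by (intro fundamental_theorem_of_calculus_interior_strong[of S] continuous_on_subset[OF cont sub])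
      (auto simp: g_def)
  then have g: "g integrable_on {a..s}" "integral {a..s} g = r s - r a"
    by (auto simp: has_integral_integrable_integral)
  have Lr: "(\<lambda>x. L * norm (r x)) integrable_on {a..s}"
    by (intro integrable_continuous_real continuous_intros continuous_on_subset[OF cont sub])
  have \<beta>s: "\<beta> integrable_on {a..s}"
    using \<beta>(1) sub by (rule integrable_on_subinterval)
  have "norm (integral {a..s} g) \<le> integral {a..s} (\<lambda>x. L * norm (r x) + \<beta> x)"
    using g(1) integrable_add[OF Lr \<beta>s]
    by (rule integral_norm_bound_integral) (use s bound \<beta>(2) \<open>0 \<le> L\<close> in \<open>auto simp: g_def\<close>)
  also have "\<dots> = integral {a..s} (\<lambda>x. L * norm (r x)) + integral {a..s} \<beta>"
    by (rule integral_add[OF Lr \<beta>s])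
  also have "integral {a..s} \<beta> \<le> integral {a..b} \<beta>"
    using sub \<beta>s \<beta>(1,2) by (intro integral_subset_le) auto
  finally have "norm (r s - r a) \<le> integral {a..s} (\<lambda>x. L * norm (r x)) + c"
    using g(2) \<beta>(3) by simp
  then show "norm (r s) \<le> norm (r a) + c + integral {a..s} (\<lambda>x. L * norm (r x))"
    using norm_triangle_sub[of "r s" "r a"] by linarith
qed (use assms in \<open>auto intro!: continuous_intros\<close>)

section \<open>Almost periodic functions\<close>

lemma rel_denseE:
  assumes "rel_dense E"
  obtains l where "l > 0" "\<And>m. \<exists>\<tau>\<in>E. m \<le> \<tau> \<and> \<tau> \<le> m + l"
  using assms unfolding rel_dense_def by fastforce

lemma rel_denseI:
  assumes "\<And>m. \<exists>\<tau>\<in>E. m \<le> \<tau> \<and> \<tau> \<le> m + l"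
  shows "rel_dense E"
proof -
  have "\<forall>m. E \<inter> {m..m + max l 1} \<noteq> {}"
    using assms by fastforce
  then show ?thesis
    unfolding rel_dense_def by (intro exI[of _ "max l 1"]) auto
qed

lemma rel_dense_mono:
  assumes "rel_dense E" "E \<subseteq> F"
  shows "rel_dense F"
proof -
  obtain l where "\<And>m. \<exists>\<tau>\<in>E. m \<le> \<tau> \<and> \<tau> \<le> m + l"
    using rel_denseE[OF assms(1)] by metis
  then show ?thesis
    using assms(2) by (intro rel_denseI[of F l]) blast
qed

lemma almost_periodicE:
  assumes "almost_periodic g" "\<epsilon> > 0"
  obtains l where "l > 0"
    "\<And>m. \<exists>\<tau>. m \<le> \<tau> \<and> \<tau> \<le> m + l \<and> (\<forall>t. norm (g (t + \<tau>) - g t) \<le> \<epsilon>)"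
proof -
  have "rel_dense {\<tau>. \<forall>t. norm (g (t + \<tau>) - g t) \<le> \<epsilon>}"
    using assms unfolding almost_periodic_def by blast
  then show ?thesis
    using that by (elim rel_denseE) blast
qed

text \<open>An almost period from the window starting at \<open>- t\<close> carries \<open>t\<close>
  into \<open>{0..l}\<close>, where compactness applies.\<close>

lemma almost_periodic_bounded:
  assumes "almost_periodic g"
  obtains C where "C > 0" "\<And>t. norm (g t) \<le> C"
proof -
  obtain l where l: "l > 0"
    "\<And>m. \<exists>\<tau>. m \<le> \<tau> \<and> \<tau> \<le> m + l \<and> (\<forall>t. norm (g (t + \<tau>) - g t) \<le> 1)"
    using almost_periodicE[OF assms, of 1] by auto
  have "compact (g ` {0..l})"
    using assms unfolding almost_periodic_def
    by (intro compact_continuous_image) (auto intro: continuous_on_subset)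
  then obtain C where C: "C > 0" "\<And>t. t \<in> {0..l} \<Longrightarrow> norm (g t) \<le> C"
    using bounded_pos[of "g ` {0..l}"] compact_imp_bounded by blast
  have "norm (g t) \<le> C + 1" for t
  proof -
    obtain \<tau> where "- t \<le> \<tau>" "\<tau> \<le> - t + l" "norm (g (t + \<tau>) - g t) \<le> 1"
      using l(2)[of "- t"] by blast
    then show ?thesis
      using C(2)[of "t + \<tau>"] norm_triangle_ineq2[of "g t" "g (t + \<tau>)"] by (simp add: norm_minus_commute)
  qed
  then show ?thesis
    using that[of "C + 1"] C(1) by simp
qed

text \<open>One almost period carries \<open>x\<close> and every nearby \<open>y\<close> together
  into the compact interval \<open>{-1..l+1}\<close>; the margin 1 is the reason for
  \<open>min d 1\<close>.\<close>

lemma almost_periodic_uniformly_continuous: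
  assumes "almost_periodic g"
  shows "uniformly_continuous_on UNIV g"
  unfolding uniformly_continuous_on_def
proof (intro allI impI)
  fix \<epsilon> :: real assume "\<epsilon> > 0"
  then have "\<epsilon> / 4 > 0" by simp
  then obtain l where l: "l > 0"
    "\<And>m. \<exists>\<tau>. m \<le> \<tau> \<and> \<tau> \<le> m + l \<and> (\<forall>t. norm (g (t + \<tau>) - g t) \<le> \<epsilon> / 4)"
    using almost_periodicE[OF assms] by metis
  have "uniformly_continuous_on {-1..l+1} g"
    using assms unfolding almost_periodic_def
    by (intro compact_uniformly_continuous) (auto intro: continuous_on_subset)
  then obtain d where d: "d > 0"
    "\<And>x y. x \<in> {-1..l+1} \<Longrightarrow> y \<in> {-1..l+1} \<Longrightarrow> dist y x < d \<Longrightarrow> dist (g y) (g x) < \<epsilon> / 4"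
    using \<open>\<epsilon> / 4 > 0\<close> unfolding uniformly_continuous_on_def by metis
  have "dist (g y) (g x) < \<epsilon>" if "dist y x < min d 1" for x y
  proof -
    obtain \<tau> where \<tau>: "- x \<le> \<tau>" "\<tau> \<le> - x + l" "\<And>t. norm (g (t + \<tau>) - g t) \<le> \<epsilon> / 4"
      using l(2)[of "- x"] by blast
    have "dist (g (y + \<tau>)) (g (x + \<tau>)) < \<epsilon> / 4"
      using that \<tau>(1,2) l(1) by (intro d(2)) (auto simp: dist_real_def)
    then show ?thesis
      using \<tau>(3)[of x] \<tau>(3)[of y] \<open>\<epsilon> > 0\<close> by norm
  qed
  then show "\<exists>d>0. \<forall>x\<in>UNIV. \<forall>y\<in>UNIV. dist y x < d \<longrightarrow> dist (g y) (g x) < \<epsilon>"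
    using d(1) by (intro exI[of _ "min d 1"]) auto
qed

text \<open>Pairing elements of the two sets that lie in a common window, the offsets fall into finitely
  many classes modulo \<open>\<eta>\<close>; subtracting a fixed representative of the class cancels the
  offset.\<close>

lemma rel_dense_common_differences:
  fixes \<sigma> :: "'i \<Rightarrow> real"
  assumes "rel_dense E" "rel_dense (\<sigma> ` Q)" "\<eta> > 0"
  shows "rel_dense {\<tau> - \<tau>' |\<tau> \<tau>'. \<tau> \<in> E \<and> \<tau>' \<in> E \<and>
           (\<exists>i\<in>Q. \<exists>i'\<in>Q. \<bar>(\<tau> - \<tau>') - (\<sigma> i - \<sigma> i')\<bar> \<le> \<eta>)}" (is "rel_dense ?D")
proof -
  obtain l1 where l1: "l1 > 0" "\<And>m. \<exists>\<tau>\<in>E. m \<le> \<tau> \<and> \<tau> \<le> m + l1"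
    using rel_denseE[OF assms(1)] by metis
  obtain l2 where l2: "l2 > 0" "\<And>m. \<exists>\<tau>\<in>\<sigma> ` Q. m \<le> \<tau> \<and> \<tau> \<le> m + l2"
    using rel_denseE[OF assms(2)] by metis
  obtain e where e: "\<And>m. e m \<in> E" "\<And>m. m \<le> e m" "\<And>m. e m \<le> m + l1"
    using l1(2) by metis
  obtain i where i: "\<And>m. i m \<in> Q" "\<And>m. m \<le> \<sigma> (i m)" "\<And>m. \<sigma> (i m) \<le> m + l2"
  proof -
    have "\<forall>m. \<exists>j. j \<in> Q \<and> m \<le> \<sigma> j \<and> \<sigma> j \<le> m + l2"
      using l2(2) by blast
    then show ?thesis
      using that by metis
  qed
  define c where "c m = \<lfloor>(e m - \<sigma> (i m)) / \<eta>\<rfloor>" for m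
  have "range c \<subseteq> {\<lfloor>- l2 / \<eta>\<rfloor>..\<lfloor>l1 / \<eta>\<rfloor>}"
  proof (rule image_subsetI)
    fix m
    have "- l2 \<le> e m - \<sigma> (i m)" "e m - \<sigma> (i m) \<le> l1"
      using e[of m] i[of m] by auto
    then show "c m \<in> {\<lfloor>- l2 / \<eta>\<rfloor>..\<lfloor>l1 / \<eta>\<rfloor>}"
      unfolding c_def atLeastAtMost_iff using \<open>\<eta> > 0\<close>
      by (intro conjI floor_mono divide_right_mono) auto
  qed
  then have fin: "finite (range c)"
    using finite_subset by blast
  \<comment> \<open>\<open>r m\<close> is a window of the same offset class as \<open>m\<close> that
    depends on the class alone, so only finitely many representatives \<open>e (r m)\<close>
    occur.\<close>
  define r where "r m = inv c (c m)" for m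
  have cr: "c (r m) = c m" for m
    unfolding r_def by (simp add: f_inv_into_f)
  have "finite (range (\<lambda>m. e (r m)))"
    using finite_imageI[OF fin, of "\<lambda>d. e (inv c d)"] by (simp add: r_def image_image)
  then obtain R where R: "\<And>m. \<bar>e (r m)\<bar> \<le> R"
    using finite_imp_bounded[of "range (\<lambda>m. e (r m))"] unfolding bounded_iff by auto
  show ?thesis
  proof (rule rel_denseI)
    fix m
    \<comment> \<open>The window is shifted by the bound \<open>R\<close> on the representatives, so
      that subtracting one cannot push the result below \<open>m\<close>.\<close>
    define x where "x = m + R"
    have "\<bar>(e x - \<sigma> (i x)) / \<eta> - (e (r x) - \<sigma> (i (r x))) / \<eta>\<bar> \<le> 1"
      using cr[of x] unfolding c_def by linarith
    moreover have "(e x - \<sigma> (i x)) / \<eta> - (e (r x) - \<sigma> (i (r x))) / \<eta>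
        = ((e x - e (r x)) - (\<sigma> (i x) - \<sigma> (i (r x)))) / \<eta>"
      by (simp add: diff_divide_distrib)
    ultimately have "\<bar>(e x - e (r x)) - (\<sigma> (i x) - \<sigma> (i (r x)))\<bar> \<le> \<eta>"
      using \<open>\<eta> > 0\<close> by (simp add: abs_divide)
    then have "e x - e (r x) \<in> ?D"
      using e(1) i(1) by blast
    moreover have "m \<le> e x - e (r x)" "e x - e (r x) \<le> m + (2 * R + l1)"
      using e(2,3)[of x] R[of x] unfolding x_def by auto
    ultimately show "\<exists>\<tau>\<in>?D. m \<le> \<tau> \<and> \<tau> \<le> m + (2 * R + l1)"
      by blast
  qed
qed

text \<open>Both estimates are used at the base point \<open>t - \<tau>'\<close>, from which the
  shift \<tau>' leads back to \<open>t\<close>.\<close>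

lemma almost_period_diff:
  fixes g :: "real \<Rightarrow> 'a::real_normed_vector"
  assumes "\<And>t. norm (g (t + \<tau>) - g t) \<le> \<epsilon>" "\<And>t. norm (g (t + \<tau>') - g t) \<le> \<epsilon>'"
  shows "norm (g (t + (\<tau> - \<tau>')) - g t) \<le> \<epsilon> + \<epsilon>'"
proof -
  have "norm (g (t - \<tau>' + \<tau>) - g (t - \<tau>' + \<tau>'))
      \<le> norm (g (t - \<tau>' + \<tau>) - g (t - \<tau>')) + norm (g (t - \<tau>' + \<tau>') - g (t - \<tau>'))"
    by norm
  also have "\<dots> \<le> \<epsilon> + \<epsilon>'"
    by (intro add_mono assms)
  finally show ?thesis
    by (simp add: algebra_simps)
qed

lemma almost_periodic_Pair:
  assumes g: "almost_periodic g" and h: "almost_periodic h"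
  shows "almost_periodic (\<lambda>t. (g t, h t))"
  unfolding almost_periodic_def
proof (intro conjI allI impI)
  show "continuous_on UNIV (\<lambda>t. (g t, h t))"
    using assms unfolding almost_periodic_def by (intro continuous_on_Pair) auto
  fix \<epsilon> :: real assume "\<epsilon> > 0"
  \<comment> \<open>The component \<open>g\<close> costs 2d and \<open>h\<close> costs 3d, one d
    being spent on replacing the almost period of \<open>h\<close> by the nearby one of
    \<open>g\<close>.\<close>
  define d where "d = \<epsilon> / 6"
  have "d > 0" using \<open>\<epsilon> > 0\<close> by (simp add: d_def)
  obtain \<eta> where \<eta>: "\<eta> > 0" "\<And>x y. dist y x < \<eta> \<Longrightarrow> dist (h y) (h x) < d"
    using almost_periodic_uniformly_continuous[OF h] \<open>d > 0\<close>
    unfolding uniformly_continuous_on_def by (metis UNIV_I)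
  let ?E = "{\<tau>. \<forall>t. norm (g (t + \<tau>) - g t) \<le> d}"
  let ?Q = "{\<tau>. \<forall>t. norm (h (t + \<tau>) - h t) \<le> d}"
  have "rel_dense ?E" "rel_dense ((\<lambda>\<tau>. \<tau>) ` ?Q)" "\<eta> / 2 > 0"
    using g h \<open>d > 0\<close> \<eta>(1) unfolding almost_periodic_def by auto
  then show "rel_dense {\<tau>. \<forall>t. norm ((g (t + \<tau>), h (t + \<tau>)) - (g t, h t)) \<le> \<epsilon>}"
  proof (rule rel_dense_mono[OF rel_dense_common_differences], clarify)
    fix \<tau> \<tau>' \<upsilon> \<upsilon>' t
    assume *: "\<forall>t. norm (g (t + \<tau>) - g t) \<le> d" "\<forall>t. norm (g (t + \<tau>') - g t) \<le> d"
      "\<forall>t. norm (h (t + \<upsilon>) - h t) \<le> d" "\<forall>t. norm (h (t + \<upsilon>') - h t) \<le> d"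
      "\<bar>\<tau> - \<tau>' - (\<upsilon> - \<upsilon>')\<bar> \<le> \<eta> / 2"
    have "norm (g (t + (\<tau> - \<tau>')) - g t) \<le> d + d"
      using * by (intro almost_period_diff) auto
    moreover have "norm (h (t + (\<upsilon> - \<upsilon>')) - h t) \<le> d + d"
      using * by (intro almost_period_diff) auto
    moreover have "norm (h (t + (\<tau> - \<tau>')) - h (t + (\<upsilon> - \<upsilon>'))) \<le> d"
      using \<eta>(2)[of "t + (\<tau> - \<tau>')" "t + (\<upsilon> - \<upsilon>')"] *(5) \<eta>(1) by (simp add: dist_norm)
    ultimately have "norm (g (t + (\<tau> - \<tau>')) - g t) + norm (h (t + (\<tau> - \<tau>')) - h t) \<le> \<epsilon>"
      using norm_diff_triangle_le[of "h (t + (\<tau> - \<tau>'))" "h (t + (\<upsilon> - \<upsilon>'))" d "h t" "d + d"]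
      \<open>\<epsilon> > 0\<close> unfolding d_def by linarith
    then show "norm ((g (t + (\<tau> - \<tau>')), h (t + (\<tau> - \<tau>'))) - (g t, h t)) \<le> \<epsilon>"
      using norm_Pair_le[of "g (t + (\<tau> - \<tau>')) - g t" "h (t + (\<tau> - \<tau>')) - h t"] by simp
  qed
qed

section \<open>Sequences with almost periodic differences\<close>

lemma admissible_seq_strict_mono:
  assumes "admissible_seq ts"
  shows "strict_mono ts"
proof (rule strict_monoI)
  show "ts m < ts n" if "m < n" for m n
    using that
  proof (induction rule: int_gr_induct)
    case base
    then show ?case using assms by (simp add: admissible_seq_def)
  next
    case (step i)
    then show ?case using assms by (meson admissible_seq_def less_trans)
  qed
qed

lemma admissible_seq_index:
  assumes "admissible_seq ts"
  obtains n where "ts n \<le> s" "s < ts (n + 1)"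
proof -
  obtain n0 where n0: "ts n0 \<le> s"
    using assms unfolding admissible_seq_def filterlim_at_bot
    by (metis eventually_at_bot_linorder order_refl)
  obtain n1 where n1: "ts n1 > s"
    using assms unfolding admissible_seq_def filterlim_at_top_dense
    by (metis eventually_at_top_linorder order_refl)
  have "n0 < n1"
    using n0 n1 strict_mono_less[OF admissible_seq_strict_mono[OF assms], of n0 n1] by linarith
  then have ex: "ts (n0 + int (nat (n1 - n0))) > s"
    using n1 by simp
  define k where "k = (LEAST k. ts (n0 + int k) > s)"
  have k: "ts (n0 + int k) > s"
    unfolding k_def using ex by (rule LeastI)
  then have "k \<noteq> 0"
    using n0 by (intro notI) simp
  then obtain j where j: "k = Suc j"
    by (cases k) auto
  then have "ts (n0 + int j) \<le> s"
    using not_less_Least[of j "\<lambda>k. ts (n0 + int k) > s"] unfolding k_def by simp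
  then show ?thesis
    using k j by (intro that[of "n0 + int j"]) (auto simp: ac_simps)
qed

lemma admissible_seq_index_unique:
  assumes "admissible_seq ts" "ts m \<le> s" "s < ts (m + 1)" "ts n \<le> s" "s < ts (n + 1)"
  shows "m = n"
proof -
  have "ts m < ts (n + 1)" "ts n < ts (m + 1)"
    using assms by auto
  then show ?thesis
    by (simp add: strict_mono_less[OF admissible_seq_strict_mono[OF assms(1)]])
qed

lemma admissible_seq_the_index:
  assumes "admissible_seq ts" "ts n \<le> s" "s < ts (n + 1)"
  shows "(THE n. ts n \<le> s \<and> s < ts (n + 1)) = n"
  using assms admissible_seq_index_unique[OF assms(1)] by (intro the_equality) blast+

lemma gamma0_eq:
  assumes "admissible_seq ts" "ts n \<le> s" "s < ts (n + 1)"
  shows "gamma0 ts s = ts n"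
  using admissible_seq_the_index[OF assms] by (simp add: gamma0_def)

lemma finite_range_admissible_seq:
  assumes "admissible_seq ts"
  shows "finite (range ts \<inter> {a..b})"
proof -
  have sm: "strict_mono ts"
    using assms by (rule admissible_seq_strict_mono)
  obtain m where m: "ts m \<le> a" "a < ts (m + 1)"
    using admissible_seq_index[OF assms] .
  obtain n where n: "ts n \<le> b" "b < ts (n + 1)"
    using admissible_seq_index[OF assms] .
  have "range ts \<inter> {a..b} \<subseteq> ts ` {m..n + 1}"
  proof clarify
    fix k assume "ts k \<in> {a..b}"
    then have "ts m \<le> ts k" "ts k \<le> ts (n + 1)"
      using m n by auto
    then show "ts k \<in> ts ` {m..n + 1}"
      by (simp add: strict_mono_less_eq[OF sm])
  qed
  then show ?thesis
    by (rule finite_subset) auto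
qed

section \<open>Consequences of H2\<close>

lemma H2E:
  assumes "H2 ts" "\<epsilon> > 0"
  obtains l where "l > 0"
    "\<And>j. \<exists>T. j \<le> T \<and> T \<le> j + int l \<and> (\<forall>n m. \<bar>(ts (m + T) - ts m) - (ts (n + T) - ts n)\<bar> \<le> \<epsilon>)"
proof -
  have "rel_dense_int (\<Inter>k\<in>{1..}. {T. \<forall>n. \<bar>tk ts k (T + n) - tk ts k n\<bar> \<le> \<epsilon>})"
    using assms unfolding H2_def by blast
  then obtain l where l: "l > 0" "\<forall>m::real. \<exists>T\<in>(\<Inter>k\<in>{1..}. {T. \<forall>n. \<bar>tk ts k (T + n) - tk ts k n\<bar> \<le> \<epsilon>}).
      m \<le> real_of_int T \<and> real_of_int T \<le> m + l"
    unfolding rel_dense_int_def by blast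
  have *: "\<exists>T. j \<le> T \<and> T \<le> j + int (nat \<lceil>l\<rceil>) \<and>
      (\<forall>n m. \<bar>(ts (m + T) - ts m) - (ts (n + T) - ts n)\<bar> \<le> \<epsilon>)" for j
  proof -
    obtain T where T: "\<And>k n. k \<ge> 1 \<Longrightarrow> \<bar>tk ts k (T + n) - tk ts k n\<bar> \<le> \<epsilon>"
      and "real_of_int j \<le> real_of_int T" "real_of_int T \<le> real_of_int j + l"
      using l(2)[rule_format, of "real_of_int j"] by auto
    then have "j \<le> T" "T \<le> j + int (nat \<lceil>l\<rceil>)"
      using l(1) by linarith+
    moreover
    \<comment> \<open>With m = n + k, the double difference in H2 is the difference of the T-step
      increments at m and n. So H2 says that the T-step increment is constant up to \<epsilon>, a
      form symmetric in m and n.\<close>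
    have less: "\<bar>(ts (m + T) - ts m) - (ts (n + T) - ts n)\<bar> \<le> \<epsilon>" if "n < m" for n m
    proof -
      have "n + int (nat (m - n)) = m" "T + n + int (nat (m - n)) = m + T"
        using that by auto
      then have "tk ts (nat (m - n)) (T + n) - tk ts (nat (m - n)) n
          = (ts (m + T) - ts m) - (ts (n + T) - ts n)"
        using that by (simp add: tk_def add.commute)
      then show ?thesis
        using T[of "nat (m - n)" n] that by simp
    qed
    have "\<bar>(ts (m + T) - ts m) - (ts (n + T) - ts n)\<bar> \<le> \<epsilon>" for n m
      using less[of n m] less[of m n] \<open>\<epsilon> > 0\<close>
      by (cases n m rule: linorder_cases) (auto simp: abs_minus_commute)
    ultimately show ?thesis by blast
  qed
  have "0 < nat \<lceil>l\<rceil>"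
    using l(1) by simp
  then show ?thesis
    using * by (rule that)
qed

text \<open>Every gap differs by at most 1 from one of the finitely many gaps with index in
  \<open>{0..l}\<close>.\<close>

lemma H2_gap_bounded:
  assumes "H2 ts"
  obtains \<theta> where "\<And>n. ts (n + 1) - ts n \<le> \<theta>"
proof -
  obtain l where l: "\<And>j. \<exists>T. j \<le> T \<and> T \<le> j + int l \<and>
      (\<forall>n m. \<bar>(ts (m + T) - ts m) - (ts (n + T) - ts n)\<bar> \<le> 1)"
    using H2E[OF assms, of 1] by (metis zero_less_one)
  define C where "C = Max ((\<lambda>k. ts (k + 1) - ts k) ` {0..int l})"
  have "ts (n + 1) - ts n \<le> C + 1" for n
  proof -
    obtain T where T: "- n \<le> T" "T \<le> - n + int l"
      "\<bar>(ts (n + 1 + T) - ts (n + 1)) - (ts (n + T) - ts n)\<bar> \<le> 1"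
      using l[of "- n"] by blast
    have "ts (n + T + 1) - ts (n + T) \<le> C"
      unfolding C_def using T(1,2) by (intro Max_ge) auto
    then show ?thesis
      using T(3) by (simp add: ac_simps abs_le_iff)
  qed
  then show ?thesis by (rule that)
qed

text \<open>Single gaps may be arbitrarily short, so the lower bound is for \<open>N\<close>
  consecutive ones. A stretch of \<open>d\<close> steps from index 0 longer than 2 recurs, up to an
  error of 1, within \<open>l\<close> indices of any place.\<close>

lemma H2_separated:
  assumes seq: "admissible_seq ts" and "H2 ts"
  obtains N where "\<And>n. ts (n + int N) \<ge> ts n + 1"
proof -
  have sm: "strict_mono ts"
    using seq by (rule admissible_seq_strict_mono)
  obtain l where l: "\<And>j. \<exists>T. j \<le> T \<and> T \<le> j + int l \<and>
      (\<forall>n m. \<bar>(ts (m + T) - ts m) - (ts (n + T) - ts n)\<bar> \<le> 1)"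
    using H2E[OF assms(2), of 1] by (metis zero_less_one)
  obtain n where n: "ts 0 + 2 < ts (n + 1)"
    using admissible_seq_index[OF seq] by metis
  define d where "d = max (n + 1) 0"
  have d: "d \<ge> 0" "ts d > ts 0 + 2"
    using n strict_mono_less_eq[OF sm, of "n + 1" d] unfolding d_def by auto
  have "ts (k + int (nat d + l)) \<ge> ts k + 1" for k
  proof -
    obtain T where T: "k \<le> T" "T \<le> k + int l" "\<bar>(ts (d + T) - ts d) - (ts (0 + T) - ts 0)\<bar> \<le> 1"
      using l[of k] by blast
    have "ts k \<le> ts T" "ts (d + T) \<le> ts (k + int (nat d + l))"
      using T(1,2) d(1) by (auto simp: strict_mono_less_eq[OF sm])
    then show ?thesis
      using T(3) d(2) by (auto simp: abs_le_iff)
  qed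
  then show ?thesis by (rule that)
qed

lemma H2_rel_dense:
  assumes seq: "admissible_seq ts" and "H2 ts" and "\<epsilon> > 0"
  shows "rel_dense ((\<lambda>T. ts T - ts 0) `
           {T. \<forall>n m. \<bar>(ts (m + T) - ts m) - (ts (n + T) - ts n)\<bar> \<le> \<epsilon>})" (is "rel_dense (_ ` ?Q)")
proof -
  have sm: "strict_mono ts"
    using seq by (rule admissible_seq_strict_mono)
  obtain l where l: "\<And>j. \<exists>T. j \<le> T \<and> T \<le> j + int l \<and>
      (\<forall>n m. \<bar>(ts (m + T) - ts m) - (ts (n + T) - ts n)\<bar> \<le> \<epsilon>)"
    using H2E[OF assms(2,3)] by metis
  obtain \<theta> where \<theta>: "\<And>n. ts (n + 1) - ts n \<le> \<theta>"
    using H2_gap_bounded[OF assms(2)] by metis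
  have steps: "ts (n + int k) \<le> ts n + real k * \<theta>" for n k
  proof (induction k)
    case (Suc k)
    then show ?case
      using \<theta>[of "n + int k"] by (simp add: algebra_simps)
  qed simp
  show ?thesis
  proof (rule rel_denseI)
    fix m
    obtain n where n: "ts n \<le> m + ts 0" "m + ts 0 < ts (n + 1)"
      using admissible_seq_index[OF seq] .
    \<comment> \<open>Starting from \<open>n + 1\<close> and not from \<open>n\<close> puts
      \<open>ts T - ts 0\<close> above \<open>m\<close>.\<close>
    obtain T where T: "n + 1 \<le> T" "T \<le> n + 1 + int l" "T \<in> ?Q"
      using l[of "n + 1"] by blast
    have "ts (n + 1) \<le> ts T" "ts T \<le> ts (n + int (1 + l))"
      using T(1,2) by (auto simp: strict_mono_less_eq[OF sm])
    then have "m \<le> ts T - ts 0" "ts T - ts 0 \<le> m + real (1 + l) * \<theta>"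
      using n steps[of n "1 + l"] by auto
    then show "\<exists>\<tau>\<in>(\<lambda>T. ts T - ts 0) ` ?Q. m \<le> \<tau> \<and> \<tau> \<le> m + real (1 + l) * \<theta>"
      using T(3) by blast
  qed
qed

text \<open>Almost periods of \<open>g\<close> are paired with the displacements
  \<open>ts T - ts 0\<close> of nearly constant index shifts. A difference of two such pairs still
  carries an index shift, \<open>T - T'\<close>, and this shift moves every point of the sequence by
  nearly the same amount.\<close>

lemma common_almost_periods:
  assumes seq: "admissible_seq ts" and "H2 ts" and g: "almost_periodic g" and "\<epsilon> > 0"
  shows "rel_dense {\<tau>. (\<forall>t. norm (g (t + \<tau>) - g t) \<le> \<epsilon>) \<and> (\<exists>T. \<forall>n. \<bar>ts (n + T) - ts n - \<tau>\<bar> \<le> \<epsilon>)}"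
proof -
  define d where "d = \<epsilon> / 3"
  have "d > 0" using \<open>\<epsilon> > 0\<close> by (simp add: d_def)
  let ?E = "{\<tau>. \<forall>t. norm (g (t + \<tau>) - g t) \<le> d}"
  let ?Q = "{T. \<forall>n m. \<bar>(ts (m + T) - ts m) - (ts (n + T) - ts n)\<bar> \<le> d}"
  have "rel_dense ?E"
    using g \<open>d > 0\<close> unfolding almost_periodic_def by blast
  then show ?thesis
  proof (rule rel_dense_mono[OF rel_dense_common_differences[OF _ H2_rel_dense[OF assms(1,2) \<open>d > 0\<close>] \<open>d > 0\<close>]],
      clarify)
    fix \<tau> \<tau>' T T'
    assume *: "\<forall>t. norm (g (t + \<tau>) - g t) \<le> d" "\<forall>t. norm (g (t + \<tau>') - g t) \<le> d"
      "\<forall>n m. \<bar>(ts (m + T) - ts m) - (ts (n + T) - ts n)\<bar> \<le> d"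
      "\<forall>n m. \<bar>(ts (m + T') - ts m) - (ts (n + T') - ts n)\<bar> \<le> d"
      "\<bar>\<tau> - \<tau>' - (ts T - ts 0 - (ts T' - ts 0))\<bar> \<le> d"
    have "norm (g (t + (\<tau> - \<tau>')) - g t) \<le> d + d" for t
      using * by (intro almost_period_diff) auto
    moreover have "d + d \<le> \<epsilon>"
      using \<open>\<epsilon> > 0\<close> by (simp add: d_def)
    ultimately have "\<forall>t. norm (g (t + (\<tau> - \<tau>')) - g t) \<le> \<epsilon>"
      using order_trans by blast
    moreover have "\<bar>ts (n + (T - T')) - ts n - (\<tau> - \<tau>')\<bar> \<le> \<epsilon>" for n
    proof -
      \<comment> \<open>From the index \<open>n - T'\<close>, the shift \<open>T'\<close> leads to
        \<open>n\<close> and the shift \<open>T\<close> to \<open>n + (T - T')\<close>.\<close>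
      have "\<bar>(ts (n + (T - T')) - ts (n - T')) - (ts T - ts 0)\<bar> \<le> d"
        using *(3)[rule_format, of "n - T'" 0] by (simp add: algebra_simps)
      moreover have "\<bar>(ts n - ts (n - T')) - (ts T' - ts 0)\<bar> \<le> d"
        using *(4)[rule_format, of "n - T'" 0] by (simp add: algebra_simps)
      ultimately show ?thesis
        using *(5) unfolding d_def by linarith
    qed
    ultimately show "(\<forall>t. norm (g (t + (\<tau> - \<tau>')) - g t) \<le> \<epsilon>) \<and>
        (\<exists>T. \<forall>n. \<bar>ts (n + T) - ts n - (\<tau> - \<tau>')\<bar> \<le> \<epsilon>)"
      by blast
  qed
qed

text \<open>The modulus of continuity in H3 is required on the closed intervals, so \<open>f\<close> has no jumps.\<close>

lemma H3_uniformly_continuous: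
  assumes seq: "admissible_seq ts" and H3: "H3 ts f"
  shows "uniformly_continuous_on UNIV f"
  unfolding uniformly_continuous_on_def
proof (intro allI impI)
  fix \<epsilon> :: real assume "\<epsilon> > 0"
  have sm: "strict_mono ts"
    using seq by (rule admissible_seq_strict_mono)
  have "H2 ts"
    using H3 by (simp add: H3_def)
  obtain N where N: "\<And>n. ts (n + int N) \<ge> ts n + 1"
    using H2_separated[OF seq \<open>H2 ts\<close>] by blast
  \<comment> \<open>Since \<open>N\<close> consecutive gaps have total length at least 1, two points
    at distance at most 1 are joined through at most N + 1 of the closed intervals, each costing at
    most \<open>e\<close>.\<close>
  define e where "e = \<epsilon> / real (N + 2)"
  have "e > 0" using \<open>\<epsilon> > 0\<close> by (simp add: e_def)
  then have "\<exists>\<delta>>0. \<forall>t' \<tau>'. \<bar>\<tau>'\<bar> \<le> \<delta> \<and>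
      (\<exists>n. t' \<in> {ts n..ts (n + 1)} \<and> t' + \<tau>' \<in> {ts n..ts (n + 1)}) \<longrightarrow>
      norm (f (t' + \<tau>') - f t') \<le> e"
    using H3 unfolding H3_def by blast
  then obtain \<delta> where \<delta>: "\<delta> > 0" "\<And>t' \<tau>' n. \<bar>\<tau>'\<bar> \<le> \<delta> \<Longrightarrow> t' \<in> {ts n..ts (n + 1)} \<Longrightarrow>
      t' + \<tau>' \<in> {ts n..ts (n + 1)} \<Longrightarrow> norm (f (t' + \<tau>') - f t') \<le> e"
    by blast
  define d where "d = min \<delta> 1"
  have step: "norm (f y - f x) \<le> e"
    if "\<bar>y - x\<bar> \<le> d" "x \<in> {ts n..ts (n + 1)}" "y \<in> {ts n..ts (n + 1)}" for x y n
    using \<delta>(2)[of "y - x" x n] that by (simp add: d_def)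
  have chain: "norm (f y - f x) \<le> real (j + 1) * e"
    if "x \<le> y" "y \<le> x + d" "ts n \<le> x" "x < ts (n + 1)" "y \<le> ts (n + 1 + int j)" for x y n j
    using that
  proof (induction j arbitrary: y)
    case 0
    then show ?case using step[of y x n] by auto
  next
    case (Suc j)
    show ?case
    proof (cases "y \<le> ts (n + 1 + int j)")
      case True
      then have "norm (f y - f x) \<le> real (j + 1) * e"
        using Suc by blast
      then show ?thesis
        using \<open>e > 0\<close> by (simp add: algebra_simps)
    next
      case False
      define z where "z = ts (n + 1 + int j)"
      have "ts (n + 1) \<le> z"
        unfolding z_def by (simp add: strict_mono_less_eq[OF sm])
      then have "norm (f z - f x) \<le> real (j + 1) * e"
        using Suc.prems False by (intro Suc.IH) (auto simp: z_def)
      moreover have "norm (f y - f z) \<le> e"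
        using Suc.prems False \<open>ts (n + 1) \<le> z\<close>
        by (intro step[of _ _ "n + 1 + int j"]) (auto simp: z_def algebra_simps)
      ultimately show ?thesis
        using norm_triangle_ineq[of "f y - f z" "f z - f x"] by (simp add: algebra_simps)
    qed
  qed
  have ordered: "norm (f y - f x) < \<epsilon>" if "x \<le> y" "y \<le> x + d" for x y
  proof -
    obtain n where n: "ts n \<le> x" "x < ts (n + 1)"
      using admissible_seq_index[OF seq] .
    have "y \<le> ts (n + 1 + int N)"
      using N[of "n + 1"] n that unfolding d_def by auto
    then have "norm (f y - f x) \<le> real (N + 1) * e"
      using chain that n by blast
    also have "\<dots> < \<epsilon>"
      using \<open>\<epsilon> > 0\<close> unfolding e_def by (simp add: field_simps)
    finally show ?thesis .
  qed
  have "dist (f y) (f x) < \<epsilon>" if "dist y x < d" for x y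
    using ordered[of x y] ordered[of y x] that
    by (cases "x \<le> y") (auto simp: dist_norm norm_minus_commute)
  then show "\<exists>d>0. \<forall>x\<in>UNIV. \<forall>y\<in>UNIV. dist y x < d \<longrightarrow> dist (f y) (f x) < \<epsilon>"
    using \<delta>(1) by (intro exI[of _ d]) (auto simp: d_def)
qed

text \<open>Pigeonhole on N + 1 candidates spaced 2\<epsilon> apart: a ball of radius \<epsilon>
  contains at most one of them, and only the N balls with index n + 1 to n + N can contain any.
  Counting candidates from 1 keeps them out of the ball about \<open>ts n\<close>.\<close>

lemma nearby_point_off_sequence:
  assumes seq: "admissible_seq ts" and N: "\<And>n. ts (n + int N) \<ge> ts n + 1"
    and "\<epsilon> > 0" "2 * real (N + 2) * \<epsilon> \<le> 1"
  obtains s' where "s \<le> s'" "s' \<le> s + 2 * real (N + 2) * \<epsilon>" "s' \<notin> (\<Union>n. {ts n - \<epsilon> <..< ts n + \<epsilon>})"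
proof -
  have sm: "strict_mono ts"
    using seq by (rule admissible_seq_strict_mono)
  obtain n where n: "ts n \<le> s" "s < ts (n + 1)"
    using admissible_seq_index[OF seq] .
  define p where "p i = s + 2 * (real i * \<epsilon>)" for i :: nat
  have "\<exists>i\<in>{1..N+1}. p i \<notin> (\<Union>n. {ts n - \<epsilon> <..< ts n + \<epsilon>})"
  proof (rule ccontr)
    assume "\<not> ?thesis"
    then have "\<forall>i\<in>{1..N+1}. \<exists>k. \<bar>p i - ts k\<bar> < \<epsilon>"
      by (auto simp: abs_less_iff) (smt (verit) atLeastAtMost_iff)
    then obtain \<kappa> where \<kappa>: "\<And>i. i \<in> {1..N+1} \<Longrightarrow> \<bar>p i - ts (\<kappa> i)\<bar> < \<epsilon>"
      by metis
    have "\<kappa> ` {1..N+1} \<subseteq> {n + 1..n + int N}"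
    proof clarify
      fix i assume i: "i \<in> {1..N+1}"
      then have "\<epsilon> \<le> real i * \<epsilon>" "real i * \<epsilon> \<le> real (N + 1) * \<epsilon>"
        using \<open>\<epsilon> > 0\<close> by (auto intro!: mult_right_mono simp: mult_le_cancel_right1)
      moreover have "2 * real (N + 2) * \<epsilon> = 2 * (real (N + 1) * \<epsilon>) + 2 * \<epsilon>"
        by (simp add: algebra_simps)
      ultimately have "ts n < ts (\<kappa> i)" "ts (\<kappa> i) < ts (n + 1 + int N)"
        using \<kappa>[OF i] n N[of "n + 1"] assms(3,4) unfolding p_def by linarith+
      then show "\<kappa> i \<in> {n + 1..n + int N}"
        by (auto simp: strict_mono_less[OF sm])
    qed
    then have "card (\<kappa> ` {1..N+1}) \<le> N"
      using card_mono[of "{n + 1..n + int N}"] by fastforce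
    then have "\<not> inj_on \<kappa> {1..N+1}"
      using card_image by fastforce
    then obtain i j where ij: "i \<in> {1..N+1}" "j \<in> {1..N+1}" "i < j" "\<kappa> i = \<kappa> j"
      unfolding inj_on_def by (metis linorder_neqE_nat)
    then have "real i * \<epsilon> + \<epsilon> \<le> real j * \<epsilon>"
      using \<open>\<epsilon> > 0\<close> mult_right_mono[of "real i + 1" "real j" \<epsilon>] by (simp add: algebra_simps)
    then show False
      using \<kappa>[OF ij(1)] \<kappa>[OF ij(2)] ij(4) unfolding p_def by auto
  qed
  then obtain i where i: "i \<in> {1..N+1}" "p i \<notin> (\<Union>n. {ts n - \<epsilon> <..< ts n + \<epsilon>})"
    by blast
  have "0 \<le> real i * \<epsilon>" "real i * \<epsilon> \<le> real (N + 2) * \<epsilon>"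
    using i(1) \<open>\<epsilon> > 0\<close> by (auto intro!: mult_right_mono)
  then have "s \<le> p i" "p i \<le> s + 2 * real (N + 2) * \<epsilon>"
    unfolding p_def by linarith+
  then show ?thesis
    using i(2) that by blast
qed

lemma H3_almost_periodic:
  assumes seq: "admissible_seq ts" and H3: "H3 ts f"
  shows "almost_periodic f"
  unfolding almost_periodic_def
proof (intro conjI allI impI)
  have unif: "uniformly_continuous_on UNIV f"
    using assms by (rule H3_uniformly_continuous)
  then show "continuous_on UNIV f"
    by (rule uniformly_continuous_imp_continuous)
  have "H2 ts"
    using H3 by (simp add: H3_def)
  obtain N where N: "\<And>n. ts (n + int N) \<ge> ts n + 1"
    using H2_separated[OF seq \<open>H2 ts\<close>] by blast
  fix \<epsilon> :: real assume "\<epsilon> > 0"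
  then have "\<epsilon> / 3 > 0" by simp
  then obtain \<eta> where \<eta>: "\<eta> > 0" "\<And>x y. dist y x < \<eta> \<Longrightarrow> dist (f y) (f x) < \<epsilon> / 3"
    using unif unfolding uniformly_continuous_on_def by (metis UNIV_I)
  define e where "e = min (\<epsilon> / 3) (min 1 (\<eta> / 2) / (2 * real (N + 2)))"
  have "e > 0"
    using \<open>\<epsilon> > 0\<close> \<eta>(1) by (simp add: e_def)
  have "e \<le> min 1 (\<eta> / 2) / (2 * real (N + 2))"
    by (simp add: e_def)
  then have "2 * real (N + 2) * e \<le> min 1 (\<eta> / 2)"
    by (simp add: field_simps)
  then have e: "2 * real (N + 2) * e \<le> 1" "2 * real (N + 2) * e \<le> \<eta> / 2"
    by auto
  have "rel_dense {\<tau>. \<forall>s. s \<notin> (\<Union>n. {ts n - e <..< ts n + e}) \<longrightarrow> norm (f (s + \<tau>) - f s) \<le> e}"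
    using H3 \<open>e > 0\<close> unfolding H3_def by blast
  then show "rel_dense {\<tau>. \<forall>t. norm (f (t + \<tau>) - f t) \<le> \<epsilon>}"
  proof (rule rel_dense_mono, intro subsetI CollectI allI)
    fix \<tau> s
    assume \<tau>: "\<tau> \<in> {\<tau>. \<forall>s. s \<notin> (\<Union>n. {ts n - e <..< ts n + e}) \<longrightarrow> norm (f (s + \<tau>) - f s) \<le> e}"
    obtain s' where s': "s \<le> s'" "s' \<le> s + 2 * real (N + 2) * e"
      "s' \<notin> (\<Union>n. {ts n - e <..< ts n + e})"
      using nearby_point_off_sequence[OF seq N \<open>e > 0\<close> e(1), of s] by blast
    have "norm (f (s' + \<tau>) - f s') \<le> e"
      using \<tau> s'(3) by blast
    moreover have "e \<le> \<epsilon> / 3"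
      by (simp add: e_def)
    moreover have "\<bar>s' - s\<bar> < \<eta>"
      using s'(1,2) e(2) \<eta>(1) by linarith
    then have "dist (f (s + \<tau>)) (f (s' + \<tau>)) < \<epsilon> / 3" "dist (f s') (f s) < \<epsilon> / 3"
      using \<eta>(2)[of "s + \<tau>" "s' + \<tau>"] \<eta>(2)[of s' s] by (auto simp: dist_real_def)
    ultimately show "norm (f (s + \<tau>) - f s) \<le> \<epsilon>"
      by norm
  qed
qed

section \<open>Bounded solutions under an exponential dichotomy\<close>

locale exponential_dichotomy =
  fixes H Phi :: "int \<Rightarrow> complex^'q^'q::finite" and P :: "complex^'q^'q" and K \<rho> :: real
  assumes invertible_Phi: "invertible (Phi n)"
    and Phi_step: "Phi (n + 1) = H n ** Phi n"
    and K_pos: "K > 0" and \<rho>: "0 < \<rho>" "\<rho> < 1"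
    and green_bound: "norm (green Phi P n k) \<le> K * \<rho> ^ nat \<bar>n - k\<bar>"
begin

lemma green_mult_vec:
  "green Phi P n k *v x =
     (if n > k then Phi n *v (P *v (matrix_inv (Phi (k + 1)) *v x))
      else - (Phi n *v (matrix_inv (Phi (k + 1)) *v x - P *v (matrix_inv (Phi (k + 1)) *v x))))"
proof -
  have neg: "(- M) *v x = - (M *v x)" for M :: "complex^'q^'q"
    using matrix_vector_mult_diff_rdistrib[of 0 M x] by simp
  show ?thesis
    by (simp add: green_def neg matrix_vector_mult_diff_rdistrib flip: matrix_vector_mul_assoc)
qed

lemma H_mult_Phi: "H n *v (Phi n *v x) = Phi (n + 1) *v x"
  by (simp add: Phi_step matrix_vector_mul_assoc)

lemma Phi_mult_inv: "Phi n *v (matrix_inv (Phi n) *v x) = x"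
  and inv_mult_Phi: "matrix_inv (Phi n) *v (Phi n *v x) = x"
  by (simp_all add: matrix_vector_mul_assoc matrix_mult_matrix_inv invertible_Phi)

text \<open>In its first index the Green function solves the homogeneous equation except at n = k,
  where the change of branch produces a jump by P + (I - P) = I.\<close>

lemma H_mult_green:
  "H n *v (green Phi P n k *v x) = green Phi P (n + 1) k *v x - (if k = n then x else 0)"
proof -
  have neg: "H n *v (- y) = - (H n *v y)" for y
    using matrix_vector_mult_diff_distrib[of "H n" 0 y] by simp
  show ?thesis
    by (auto simp: green_mult_vec neg H_mult_Phi matrix_vector_mult_diff_distrib Phi_mult_inv)
qed

lemma norm_green_mult_vec_le:
  assumes "norm x \<le> R"
  shows "norm (green Phi P n k *v x) \<le> K * \<rho> ^ nat \<bar>n - k\<bar> * R"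
proof -
  have "norm (green Phi P n k *v x) \<le> norm (green Phi P n k) * norm x"
    by (rule norm_matrix_vector_mult_le)
  also have "\<dots> \<le> K * \<rho> ^ nat \<bar>n - k\<bar> * R"
    using green_bound assms K_pos \<rho> by (intro mult_mono) auto
  finally show ?thesis .
qed

lemma summable_geometric_bound: "summable (\<lambda>j. K * \<rho> ^ j * R)"
  using \<rho> by (intro summable_mult2 summable_mult summable_geometric) auto

lemma suminf_geometric_bound: "(\<Sum>j. K * \<rho> ^ j * R) = K * R / (1 - \<rho>)"
proof -
  have "(\<lambda>j. K * \<rho> ^ j * R) sums (K * (1 / (1 - \<rho>)) * R)"
    using \<rho> by (intro sums_mult sums_mult2 geometric_sums) auto
  then show ?thesis
    by (simp add: sums_iff)
qed

lemma sum_geometric_bound: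
  assumes "0 \<le> R"
  shows "(\<Sum>j<m. K * \<rho> ^ j * R) \<le> K * R / (1 - \<rho>)"
  using sum_le_suminf[OF summable_geometric_bound, of "{..<m}" R] assms K_pos \<rho>
  by (simp add: suminf_geometric_bound)

lemma le_of_geometric_error:
  assumes "\<And>j. x \<le> c * \<rho> ^ j + d"
  shows "x \<le> d"
proof -
  have "(\<lambda>j. c * \<rho> ^ j + d) \<longlonglongrightarrow> c * 0 + d"
    using \<rho> by (intro tendsto_intros LIMSEQ_realpow_zero) auto
  then show ?thesis
    using assms LIMSEQ_le_const[of "\<lambda>j. c * \<rho> ^ j + d" "c * 0 + d" x] by auto
qed

text \<open>In the coordinates \<psi> the homogeneous evolution is trivial, so \<psi> telescopes.
  The \<open>P\<close> component is summed from the past and the complementary one from the future,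
  the directions in which the Green function decays; boundedness of \<phi> then kills the far
  terms.\<close>

theorem bounded_solution_bound:
  assumes bounded: "\<And>n. norm (\<phi> n) \<le> C"
    and step: "\<And>n. \<phi> (n + 1) = H n *v \<phi> n + r n" and r: "\<And>n. norm (r n) \<le> R"
  shows "norm (\<phi> n) \<le> 2 * K / (1 - \<rho>) * R"
proof -
  have "R \<ge> 0"
    using r[of 0] norm_ge_zero order_trans by blast
  define \<psi> where "\<psi> k = matrix_inv (Phi k) *v \<phi> k" for k
  have \<phi>: "\<phi> k = Phi k *v \<psi> k" for k
    by (simp add: \<psi>_def Phi_mult_inv)
  have \<psi>_step: "\<psi> (k + 1) = \<psi> k + matrix_inv (Phi (k + 1)) *v r k" for k
    using step[of k] \<phi>[of k]
    by (simp add: \<psi>_def[of "k + 1"] H_mult_Phi matrix_vector_right_distrib inv_mult_Phi)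
  have past: "Phi n *v (P *v \<psi> n) = Phi n *v (P *v \<psi> (n - int j))
      + (\<Sum>i<j. green Phi P n (n - 1 - int i) *v r (n - 1 - int i))" for j
  proof (induction j)
    case (Suc j)
    have "\<psi> (n - int j) = \<psi> (n - int (Suc j)) + matrix_inv (Phi (n - int j)) *v r (n - 1 - int j)"
      using \<psi>_step[of "n - 1 - int j"] by (simp add: algebra_simps)
    then have "Phi n *v (P *v \<psi> (n - int j)) = Phi n *v (P *v \<psi> (n - int (Suc j)))
        + green Phi P n (n - 1 - int j) *v r (n - 1 - int j)"
      by (simp add: green_mult_vec matrix_vector_right_distrib)
    then show ?case
      using Suc by simp
  qed simp
  have future: "Phi n *v (\<psi> n - P *v \<psi> n) = Phi n *v (\<psi> (n + int j) - P *v \<psi> (n + int j))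
      + (\<Sum>i<j. green Phi P n (n + int i) *v r (n + int i))" for j
  proof (induction j)
    case (Suc j)
    have "\<psi> (n + int (Suc j)) = \<psi> (n + int j) + matrix_inv (Phi (n + int j + 1)) *v r (n + int j)"
      using \<psi>_step[of "n + int j"] by (simp add: algebra_simps)
    then have "Phi n *v (\<psi> (n + int (Suc j)) - P *v \<psi> (n + int (Suc j)))
        = Phi n *v (\<psi> (n + int j) - P *v \<psi> (n + int j)) - green Phi P n (n + int j) *v r (n + int j)"
      by (simp add: green_mult_vec matrix_vector_right_distrib matrix_vector_mult_diff_distrib)
    then show ?case
      using Suc by simp
  qed simp
  have "norm (Phi n *v (P *v \<psi> n)) \<le> K * \<rho> * C * \<rho> ^ j + K * (\<rho> * R) / (1 - \<rho>)" for j
  proof -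
    \<comment> \<open>The far term is the Green function at distance j + 1 applied to a value of the
      bounded sequence, so it vanishes as j grows.\<close>
    have "Phi n *v (P *v \<psi> (n - int j)) = green Phi P n (n - int j - 1) *v \<phi> (n - int j)"
      by (simp add: green_mult_vec \<psi>_def)
    also have "norm \<dots> \<le> K * \<rho> ^ (j + 1) * C"
      using norm_green_mult_vec_le[OF bounded[of "n - int j"], of n "n - int j - 1"]
      by (simp add: nat_add_distrib)
    finally have "norm (Phi n *v (P *v \<psi> (n - int j))) \<le> K * \<rho> * C * \<rho> ^ j"
      by (simp add: mult_ac)
    moreover have "norm (\<Sum>i<j. green Phi P n (n - 1 - int i) *v r (n - 1 - int i))
        \<le> (\<Sum>i<j. K * \<rho> ^ i * (\<rho> * R))"
    proof (rule sum_norm_le)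
      fix i
      show "norm (green Phi P n (n - 1 - int i) *v r (n - 1 - int i)) \<le> K * \<rho> ^ i * (\<rho> * R)"
        using norm_green_mult_vec_le[OF r[of "n - 1 - int i"], of n "n - 1 - int i"]
        by (simp add: nat_add_distrib mult_ac)
    qed
    moreover have "(\<Sum>i<j. K * \<rho> ^ i * (\<rho> * R)) \<le> K * (\<rho> * R) / (1 - \<rho>)"
      using \<open>R \<ge> 0\<close> \<rho> by (intro sum_geometric_bound) auto
    ultimately show ?thesis
      unfolding past[of j]
      using norm_triangle_ineq[of "Phi n *v (P *v \<psi> (n - int j))"
          "\<Sum>i<j. green Phi P n (n - 1 - int i) *v r (n - 1 - int i)"] by linarith
  qed
  then have past_bound: "norm (Phi n *v (P *v \<psi> n)) \<le> K * (\<rho> * R) / (1 - \<rho>)"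
    by (rule le_of_geometric_error)
  have "norm (Phi n *v (\<psi> n - P *v \<psi> n)) \<le> K * C * \<rho> ^ j + K * R / (1 - \<rho>)" for j
  proof -
    \<comment> \<open>The inverse in \<open>green\<close> carries the index k + 1, so the far term
      at n + j + 1 belongs to k = n + j, which lies on the future branch. Hence the expansion is
      used with \<open>Suc j\<close> terms.\<close>
    have "Phi n *v (\<psi> (n + int (Suc j)) - P *v \<psi> (n + int (Suc j)))
        = - (green Phi P n (n + int j) *v \<phi> (n + int (Suc j)))"
      by (simp add: green_mult_vec \<psi>_def add_ac)
    also have "norm \<dots> \<le> K * \<rho> ^ j * C"
      using norm_green_mult_vec_le[OF bounded[of "n + int (Suc j)"], of n "n + int j"] by simp
    finally have "norm (Phi n *v (\<psi> (n + int (Suc j)) - P *v \<psi> (n + int (Suc j)))) \<le> K * C * \<rho> ^ j"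
      by (simp add: mult_ac)
    moreover have "norm (\<Sum>i<Suc j. green Phi P n (n + int i) *v r (n + int i))
        \<le> (\<Sum>i<Suc j. K * \<rho> ^ i * R)"
    proof (rule sum_norm_le)
      fix i
      show "norm (green Phi P n (n + int i) *v r (n + int i)) \<le> K * \<rho> ^ i * R"
        using norm_green_mult_vec_le[OF r[of "n + int i"], of n "n + int i"] by simp
    qed
    moreover have "(\<Sum>i<Suc j. K * \<rho> ^ i * R) \<le> K * R / (1 - \<rho>)"
      using \<open>R \<ge> 0\<close> by (rule sum_geometric_bound)
    ultimately show ?thesis
      unfolding future[of "Suc j"]
      using norm_triangle_ineq[of "Phi n *v (\<psi> (n + int (Suc j)) - P *v \<psi> (n + int (Suc j)))"
          "\<Sum>i<Suc j. green Phi P n (n + int i) *v r (n + int i)"] by linarith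
  qed
  then have future_bound: "norm (Phi n *v (\<psi> n - P *v \<psi> n)) \<le> K * R / (1 - \<rho>)"
    by (rule le_of_geometric_error)
  have "\<phi> n = Phi n *v (P *v \<psi> n) + Phi n *v (\<psi> n - P *v \<psi> n)"
    by (simp add: \<phi> flip: matrix_vector_right_distrib)
  then have "norm (\<phi> n) \<le> K * (\<rho> * R) / (1 - \<rho>) + K * R / (1 - \<rho>)"
    using norm_triangle_le[OF add_mono[OF past_bound future_bound]] by simp
  \<comment> \<open>The past sum starts at distance 1, the future sum at distance 0. Dropping the
    extra \<rho> turns K(1 + \<rho>)/(1 - \<rho>) into 2K/(1 - \<rho>).\<close>
  also have "K * (\<rho> * R) / (1 - \<rho>) \<le> K * R / (1 - \<rho>)"
    using K_pos \<rho> \<open>R \<ge> 0\<close>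
    by (intro divide_right_mono mult_left_mono) (auto simp: mult_le_cancel_right2)
  finally show ?thesis
    by simp
qed

text \<open>The solution is the sum over all integers k of \<open>green Phi P n k *v h k\<close>,
  split into the one-sided series \<open>p\<close> (k < n) and \<open>q\<close> (k at least
  n).\<close>

theorem bounded_solution_exists:
  assumes h: "\<And>n. norm (h n) \<le> R"
  obtains \<phi> C where "\<And>n. norm (\<phi> n) \<le> C" "\<And>n. \<phi> (n + 1) = H n *v \<phi> n + h n"
proof -
  define p where "p n j = green Phi P n (n - 1 - int j) *v h (n - 1 - int j)" for n j
  define q where "q n j = green Phi P n (n + int j) *v h (n + int j)" for n j
  have "R \<ge> 0"
    using h[of 0] norm_ge_zero order_trans by blast
  have p: "norm (p n j) \<le> K * \<rho> ^ j * R" for n j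
  proof -
    have "norm (p n j) \<le> K * \<rho> ^ (j + 1) * R"
      using norm_green_mult_vec_le[OF h[of "n - 1 - int j"], of n "n - 1 - int j"]
      by (simp add: p_def nat_add_distrib)
    also have "\<dots> \<le> K * \<rho> ^ j * R"
      using K_pos \<rho> \<open>R \<ge> 0\<close> by (intro mult_right_mono mult_left_mono power_decreasing) auto
    finally show ?thesis .
  qed
  have q: "norm (q n j) \<le> K * \<rho> ^ j * R" for n j
    using norm_green_mult_vec_le[OF h[of "n + int j"], of n "n + int j"] by (simp add: q_def)
  have sp: "summable (p n)" and sq: "summable (q n)" for n
    using summable_comparison_test'[OF summable_geometric_bound p]
      summable_comparison_test'[OF summable_geometric_bound q] by auto
  define \<phi> where "\<phi> n = suminf (p n) + suminf (q n)" for n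
  have "norm (\<phi> n) \<le> 2 * (K * R / (1 - \<rho>))" for n
    unfolding \<phi>_def
    using norm_suminf_le[OF p[of n] summable_geometric_bound]
      norm_suminf_le[OF q[of n] summable_geometric_bound]
    by (intro norm_triangle_le) (simp add: suminf_geometric_bound)
  moreover have "\<phi> (n + 1) = H n *v \<phi> n + h n" for n
  proof -
    have Hp: "H n *v p n j = p (n + 1) (Suc j)" for j
      by (simp add: p_def H_mult_green algebra_simps)
    have "H n *v suminf (p n) = (\<Sum>j. p (n + 1) (Suc j))"
      using bounded_linear.suminf[OF bounded_linear_matrix_vector_mult_right sp[of n], of "H n"]
      by (simp add: Hp)
    then have P: "H n *v suminf (p n) = suminf (p (n + 1)) - p (n + 1) 0"
      using suminf_split_head[OF sp] by simp
    have Hq: "H n *v q n (Suc j) = q (n + 1) j" for j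
      by (simp add: q_def H_mult_green algebra_simps)
    have "suminf (q n) = (\<Sum>j. q n (Suc j)) + q n 0"
      using suminf_split_head[OF sq[of n]] by simp
    moreover have "H n *v (\<Sum>j. q n (Suc j)) = suminf (q (n + 1))"
      using bounded_linear.suminf[OF bounded_linear_matrix_vector_mult_right,
          of "\<lambda>j. q n (Suc j)" "H n"]
        sq[of n] by (simp add: Hq summable_Suc_iff)
    \<comment> \<open>The term k = n passes from the future series to the past one, and the jump of
      the Green function supplies \<open>h n\<close>.\<close>
    moreover have "H n *v q n 0 = p (n + 1) 0 - h n"
      by (simp add: p_def q_def H_mult_green)
    ultimately show ?thesis
      by (simp add: \<phi>_def matrix_vector_right_distrib P)
  qed
  ultimately show ?thesis
    by (rule that)
qed

end

section \<open>Equations with piecewise constant argument\<close>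

text \<open>The interval \<open>{c..d}\<close> may stick out of \<open>{p..q}\<close>; this happens
  below when \<eta> exceeds a gap.\<close>

lemma indicator_interval_integral_le:
  fixes c d :: real
  assumes "c \<le> d"
  shows "indicat_real {c..d} integrable_on {p..q}" "integral {p..q} (indicat_real {c..d}) \<le> d - c"
proof -
  have meas: "{c..d} \<inter> {p..q} \<in> lmeasurable"
    by (intro fmeasurable.Int) auto
  then show "indicat_real {c..d} integrable_on {p..q}"
    by (simp add: integrable_on_indicator)
  have "integral {p..q} (indicat_real {c..d}) = measure lebesgue ({c..d} \<inter> {p..q})"
    using meas by (rule integral_indicator)
  also have "\<dots> \<le> measure lebesgue {c..d}"
    using meas by (intro measure_mono_fmeasurable fmeasurableD) auto
  finally show "integral {p..q} (indicat_real {c..d}) \<le> d - c"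
    using assms by simp
qed

locale piecewise_constant_argument =
  fixes ts :: "int \<Rightarrow> real" and A B X :: "real \<Rightarrow> complex^'q^'q::finite"
    and Phi :: "int \<Rightarrow> complex^'q^'q" and P :: "complex^'q^'q" and K \<rho> a b \<theta> :: real
  assumes seq: "admissible_seq ts" and fund: "fundamental_matrix A X"
    and dich: "H6 ts X B Phi P K \<rho>"
    and continuous_B: "continuous_on UNIV B"
    and A_le: "norm (A s) \<le> a" and B_le: "norm (B s) \<le> b"
    and gap: "ts (n + 1) - ts n \<le> \<theta>"
begin

sublocale exponential_dichotomy "Hmat ts X B" Phi P K \<rho>
  using dich unfolding H6_def by unfold_locales auto

lemma a_nonneg: "0 \<le> a" and b_nonneg: "0 \<le> b"
  using A_le B_le norm_ge_zero order_trans by blast+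

lemma ts_less: "ts n < ts (n + 1)"
  using seq by (simp add: admissible_seq_def)

lemma \<theta>_pos: "0 < \<theta>"
  using ts_less[of 0] gap[of 0] by simp

lemma A_mult_le: "norm (A s *v x) \<le> a * norm x"
  by (rule order_trans[OF norm_matrix_vector_mult_le]) (simp add: A_le mult_right_mono)

lemma B_mult_le: "norm (B s *v x) \<le> b * norm x"
  by (rule order_trans[OF norm_matrix_vector_mult_le]) (simp add: B_le mult_right_mono)

lemma exp_gap_le: "t \<in> {ts n..ts (n + 1)} \<Longrightarrow> exp (a * (t - ts n)) \<le> exp (a * \<theta>)"
  using gap[of n] a_nonneg by (simp add: mult_left_mono)

section \<open>Variation of constants on a single interval\<close>

lemma X_mult_inv: "X t *v (matrix_inv (X t) *v x) = x"
  and inv_mult_X: "matrix_inv (X t) *v (X t *v x) = x"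
  using fund unfolding fundamental_matrix_def
  by (simp_all add: matrix_vector_mul_assoc matrix_mult_matrix_inv)

lemma continuous_X_inv: "continuous_on S (\<lambda>t. matrix_inv (X t))"
proof (rule continuous_on_matrix_inv)
  show "continuous_on S X"
    using fund unfolding fundamental_matrix_def
    by (auto intro!: continuous_at_imp_continuous_on has_vector_derivative_continuous)
qed (use fund in \<open>auto simp: fundamental_matrix_def\<close>)

text \<open>Variation of constants: the solution of x' = A x + g with value \<open>v\<close> at
  \<open>ts n\<close>. The forcing \<open>B u *v v + f u\<close>, with the delayed value frozen at
  \<open>v\<close>, gives the original equation on the interval.\<close>

definition flow :: "int \<Rightarrow> complex^'q \<Rightarrow> (real \<Rightarrow> complex^'q) \<Rightarrow> real \<Rightarrow> complex^'q" where
  "flow n v g t =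
     X t *v (matrix_inv (X (ts n)) *v v + integral {ts n..t} (\<lambda>u. matrix_inv (X u) *v g u))"

lemma flow_start: "flow n v g (ts n) = v"
  by (simp add: flow_def X_mult_inv)

lemma flow_has_derivative:
  assumes "continuous_on UNIV g" "t \<in> {ts n..ts (n + 1)}"
  shows "(flow n v g has_vector_derivative (A t *v flow n v g t + g t))
           (at t within {ts n..ts (n + 1)})"
proof -
  let ?I = "\<lambda>t. matrix_inv (X (ts n)) *v v + integral {ts n..t} (\<lambda>u. matrix_inv (X u) *v g u)"
  have "continuous_on {ts n..ts (n + 1)} (\<lambda>u. matrix_inv (X u) *v g u)"
    by (intro continuous_on_matrix_vector_mult continuous_X_inv continuous_on_subset[OF assms(1)]) auto
  then have "((\<lambda>t. integral {ts n..t} (\<lambda>u. matrix_inv (X u) *v g u)) has_vector_derivative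
      matrix_inv (X t) *v g t) (at t within {ts n..ts (n + 1)})"
    using assms(2) by (rule integral_has_vector_derivative)
  then have "(?I has_vector_derivative matrix_inv (X t) *v g t) (at t within {ts n..ts (n + 1)})"
    using has_vector_derivative_add[OF has_vector_derivative_const] by fastforce
  moreover have "(X has_vector_derivative (A t ** X t)) (at t within {ts n..ts (n + 1)})"
    using fund unfolding fundamental_matrix_def by (blast intro: has_vector_derivative_at_within)
  ultimately have "((\<lambda>t. X t *v ?I t) has_vector_derivative
      (X t *v (matrix_inv (X t) *v g t) + (A t ** X t) *v ?I t)) (at t within {ts n..ts (n + 1)})"
    by (intro bounded_bilinear.has_vector_derivative[OF bounded_bilinear_matrix_vector_mult])
  then show ?thesis
    by (simp add: flow_def[abs_def] X_mult_inv add.commute flip: matrix_vector_mul_assoc)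
qed

lemma flow_continuous: "continuous_on UNIV g \<Longrightarrow> continuous_on {ts n..ts (n + 1)} (flow n v g)"
  using flow_has_derivative[of g] has_vector_derivative_continuous
  by (fastforce simp: continuous_on_eq_continuous_within)

lemma continuous_B_mult: "continuous_on UNIV (\<lambda>u. B u *v v)"
  by (intro continuous_on_matrix_vector_mult continuous_B continuous_on_const)

lemma flow_add:
  assumes "continuous_on UNIV g" "continuous_on UNIV h"
  shows "flow n v (\<lambda>u. g u + h u) t = flow n v g t + flow n 0 h t"
proof -
  have "integral {ts n..t} (\<lambda>u. matrix_inv (X u) *v g u + matrix_inv (X u) *v h u)
      = integral {ts n..t} (\<lambda>u. matrix_inv (X u) *v g u) + integral {ts n..t} (\<lambda>u. matrix_inv (X u) *v h u)"
    by (intro integral_add integrable_continuous_real continuous_on_matrix_vector_mult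
        continuous_X_inv continuous_on_subset[OF assms(1)] continuous_on_subset[OF assms(2)]) auto
  then show ?thesis
    by (simp add: flow_def matrix_vector_right_distrib add.assoc)
qed

text \<open>This links the differential equation to the difference equation of H6: the integral in
  \<open>Jn\<close> applied to \<open>v\<close> is the variation of constants integral with
  \<open>X (ts n)\<close> pulled inside.\<close>

lemma flow_end: "flow n v (\<lambda>u. B u *v v) (ts (n + 1)) = Hmat ts X B n *v v"
proof -
  let ?J = "{ts n..ts (n + 1)}"
  have cont: "continuous_on ?J (\<lambda>u. matrix_inv (X u) *v (B u *v v))"
    by (intro continuous_on_matrix_vector_mult continuous_X_inv continuous_on_const
        continuous_on_subset[OF continuous_B]) auto
  have "(\<lambda>u. Xts X (ts n) u ** B u) integrable_on ?J"
    unfolding Xts_def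
    by (intro integrable_continuous_real continuous_on_matrix_matrix_mult continuous_X_inv
        continuous_on_const continuous_on_subset[OF continuous_B]) auto
  then have "integral ?J (\<lambda>u. Xts X (ts n) u ** B u) *v v
      = integral ?J (\<lambda>u. (Xts X (ts n) u ** B u) *v v)"
    using integral_linear[OF _ bounded_linear_matrix_vector_mult_left[of v]]
    by (fastforce simp: o_def)
  also have "\<dots> = integral ?J (\<lambda>u. X (ts n) *v (matrix_inv (X u) *v (B u *v v)))"
    by (simp add: Xts_def matrix_vector_mul_assoc matrix_mul_assoc)
  also have "\<dots> = X (ts n) *v integral ?J (\<lambda>u. matrix_inv (X u) *v (B u *v v))"
    using integral_linear[OF integrable_continuous_real[OF cont]
        bounded_linear_matrix_vector_mult_right[of "X (ts n)"]]
    by (simp add: o_def)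
  finally have "Jn ts X B n (ts (n + 1)) *v v
      = v + X (ts n) *v integral ?J (\<lambda>u. matrix_inv (X u) *v (B u *v v))"
    by (simp add: Jn_def matrix_vector_mult_add_rdistrib)
  then show ?thesis
    by (simp add: Hmat_def Xts_def flow_def matrix_vector_right_distrib inv_mult_X
        flip: matrix_vector_mul_assoc)
qed

text \<open>The residual of the homogeneous equation is dominated by some \<beta> of small integral,
  so the residual itself need not be shown integrable. The set \<open>S\<close> depends on the
  interval because the derivative of a translate of a solution may jump at interior points.\<close>

definition defect_le :: "(real \<Rightarrow> complex^'q) \<Rightarrow> real \<Rightarrow> bool" where
  "defect_le w \<delta> \<longleftrightarrow> continuous_on UNIV w \<and>
     (\<forall>n. \<exists>S w' \<beta>. finite S \<and>
        (\<forall>s\<in>{ts n<..<ts (n + 1)} - S. (w has_vector_derivative w' s) (at s) \<and>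
           norm (w' s - A s *v w s - B s *v w (ts n)) \<le> \<beta> s) \<and>
        \<beta> integrable_on {ts n..ts (n + 1)} \<and> (\<forall>s\<in>{ts n..ts (n + 1)}. 0 \<le> \<beta> s) \<and>
        integral {ts n..ts (n + 1)} \<beta> \<le> \<delta>)"

lemma defect_le_step:
  assumes "defect_le w \<delta>"
  shows defect_le_endpoint: "norm (w (ts (n + 1)) - Hmat ts X B n *v w (ts n)) \<le> exp (a * \<theta>) * \<delta>"
    and defect_le_interval: "\<And>t. t \<in> {ts n..ts (n + 1)} \<Longrightarrow>
      norm (w t) \<le> exp (a * \<theta>) * (1 + b * \<theta>) * norm (w (ts n)) + exp (a * \<theta>) * \<delta>"
proof -
  let ?J = "{ts n..ts (n + 1)}" and ?v = "w (ts n)"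
  obtain S w' \<beta> where S: "finite S"
    and der: "\<And>s. s \<in> {ts n<..<ts (n + 1)} - S \<Longrightarrow> (w has_vector_derivative w' s) (at s)"
    and le: "\<And>s. s \<in> {ts n<..<ts (n + 1)} - S \<Longrightarrow> norm (w' s - A s *v w s - B s *v ?v) \<le> \<beta> s"
    and \<beta>: "\<beta> integrable_on ?J" "\<And>s. s \<in> ?J \<Longrightarrow> 0 \<le> \<beta> s" "integral ?J \<beta> \<le> \<delta>"
    using assms unfolding defect_le_def by metis
  have cont: "continuous_on ?J w"
    using assms unfolding defect_le_def by (blast intro: continuous_on_subset)
  have "0 \<le> \<delta>"
    using \<beta> integral_nonneg order_trans by blast
  define p where "p = flow n ?v (\<lambda>u. B u *v ?v)"
  have "norm (w (ts (n + 1)) - p (ts (n + 1)))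
      \<le> (norm (w (ts n) - p (ts n)) + \<delta>) * exp (a * (ts (n + 1) - ts n))"
  proof (rule gronwall_derivative[OF _ S a_nonneg _ _ _ \<beta>])
    show "continuous_on ?J (\<lambda>t. w t - p t)"
      unfolding p_def by (intro continuous_on_diff cont flow_continuous continuous_B_mult)
    fix s assume s: "s \<in> {ts n<..<ts (n + 1)} - S"
    have "(p has_vector_derivative (A s *v p s + B s *v ?v)) (at s within ?J)"
      using s unfolding p_def by (intro flow_has_derivative continuous_B_mult) auto
    then have "(p has_vector_derivative (A s *v p s + B s *v ?v)) (at s)"
      using s by (simp add: at_within_Icc_at)
    then show "((\<lambda>t. w t - p t) has_vector_derivative (w' s - (A s *v p s + B s *v ?v))) (at s)"
      using der[OF s] by (rule has_vector_derivative_diff[rotated])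
    have eq: "w' s - (A s *v p s + B s *v ?v) = A s *v (w s - p s) + (w' s - A s *v w s - B s *v ?v)"
      by (simp add: matrix_vector_mult_diff_distrib)
    show "norm (w' s - (A s *v p s + B s *v ?v)) \<le> a * norm (w s - p s) + \<beta> s"
      unfolding eq by (rule norm_triangle_mono[OF A_mult_le le[OF s]])
  qed (use ts_less[of n] in auto)
  also have "\<dots> \<le> \<delta> * exp (a * \<theta>)"
    using exp_gap_le[of "ts (n + 1)" n] ts_less[of n] \<open>0 \<le> \<delta>\<close>
    by (simp add: p_def flow_start mult_left_mono)
  finally show "norm (w (ts (n + 1)) - Hmat ts X B n *v w (ts n)) \<le> exp (a * \<theta>) * \<delta>"
    by (simp add: p_def flow_end mult.commute)
  fix t assume t: "t \<in> ?J"
  have "norm (w t) \<le> (norm ?v + (b * \<theta> * norm ?v + \<delta>)) * exp (a * (t - ts n))"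
  proof (rule gronwall_derivative[OF cont S a_nonneg t der])
    fix s assume s: "s \<in> {ts n<..<ts (n + 1)} - S"
    have "w' s = A s *v w s + (B s *v ?v + (w' s - A s *v w s - B s *v ?v))"
      by simp
    then show "norm (w' s) \<le> a * norm (w s) + (b * norm ?v + \<beta> s)"
      using norm_triangle_mono[OF A_mult_le norm_triangle_mono[OF B_mult_le le[OF s]]] by metis
  next
    show "(\<lambda>s. b * norm ?v + \<beta> s) integrable_on ?J"
      using \<beta>(1) by (intro integrable_add integrable_const_ivl)
    have "integral ?J (\<lambda>s. b * norm ?v + \<beta> s) = (ts (n + 1) - ts n) * (b * norm ?v) + integral ?J \<beta>"
      using \<beta>(1) ts_less[of n] by (subst integral_add) (auto intro: integrable_const_ivl)
    also have "(ts (n + 1) - ts n) * (b * norm ?v) \<le> \<theta> * (b * norm ?v)"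
      using gap b_nonneg by (intro mult_right_mono) auto
    finally show "integral ?J (\<lambda>s. b * norm ?v + \<beta> s) \<le> b * \<theta> * norm ?v + \<delta>"
      using \<beta>(3) by (simp add: mult_ac)
  qed (use \<beta>(2) b_nonneg in auto)
  also have "\<dots> \<le> (norm ?v + (b * \<theta> * norm ?v + \<delta>)) * exp (a * \<theta>)"
    using exp_gap_le[OF t] \<open>0 \<le> \<delta>\<close> b_nonneg \<theta>_pos by (intro mult_left_mono) auto
  finally show "norm (w t) \<le> exp (a * \<theta>) * (1 + b * \<theta>) * norm (w (ts n)) + exp (a * \<theta>) * \<delta>"
    by (simp add: algebra_simps)
qed

text \<open>The values at the \<open>ts n\<close> are at most 2K/(1-\<rho>) exp(a\<theta>) \<delta>;
  the first summand carries this across an interval, and the second is the defect accumulated there.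
  \<open>gain * \<theta>\<close> is the constant of the theorem with each sqrt q replaced by
  1.\<close>

definition gain :: real where
  "gain = (exp (a * \<theta>) * (1 + b * \<theta>) * (2 * K / (1 - \<rho>)) + 1) * exp (a * \<theta>)"

lemma gain_nonneg: "0 \<le> gain"
  unfolding gain_def using b_nonneg \<theta>_pos K_pos \<rho> by simp

text \<open>The samples \<open>w (ts k)\<close> satisfy the difference equation up to
  \<open>exp (a * \<theta>) * \<delta>\<close>, so the dichotomy bounds them, and the interval
  estimate fills in the times between.\<close>

lemma bounded_defect_bound:
  assumes "defect_le w \<delta>" and bounded: "\<And>t. norm (w t) \<le> C"
  shows "norm (w t) \<le> gain * \<delta>"
proof -
  obtain n where n: "ts n \<le> t" "t < ts (n + 1)"
    using admissible_seq_index[OF seq] .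
  have "norm (w (ts n)) \<le> 2 * K / (1 - \<rho>) * (exp (a * \<theta>) * \<delta>)"
  proof (rule bounded_solution_bound[OF bounded])
    show "w (ts (k + 1)) = Hmat ts X B k *v w (ts k) + (w (ts (k + 1)) - Hmat ts X B k *v w (ts k))" for k
      by simp
  qed (rule defect_le_endpoint[OF assms(1)])
  then have "exp (a * \<theta>) * (1 + b * \<theta>) * norm (w (ts n))
      \<le> exp (a * \<theta>) * (1 + b * \<theta>) * (2 * K / (1 - \<rho>) * (exp (a * \<theta>) * \<delta>))"
    using b_nonneg \<theta>_pos by (intro mult_left_mono) auto
  moreover have "gain * \<delta>
      = exp (a * \<theta>) * (1 + b * \<theta>) * (2 * K / (1 - \<rho>) * (exp (a * \<theta>) * \<delta>)) + exp (a * \<theta>) * \<delta>"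
    unfolding gain_def by (simp only: distrib_right mult_1 mult.assoc)
  ultimately show ?thesis
    using defect_le_interval[OF assms(1), of t n] n by simp
qed

section \<open>Bounded solutions: estimate, uniqueness, existence\<close>

lemma notin_range_ts: "s \<in> {ts n<..<ts (n + 1)} \<Longrightarrow> s \<notin> range ts"
  using strict_mono_less[OF admissible_seq_strict_mono[OF seq]] by auto

lemma is_solution_has_derivative:
  assumes "is_solution ts A B f y" "s \<in> {ts n<..<ts (n + 1)}"
  shows "(y has_vector_derivative (A s *v y s + B s *v y (ts n) + f s)) (at s)"
  using assms notin_range_ts[OF assms(2)] gamma0_eq[OF seq, of n s] unfolding is_solution_def
  by (metis greaterThanLessThan_iff less_imp_le)

text \<open>The forcing term itself is regarded as the defect, with constant \<beta>.\<close>

lemma is_solution_defect_le: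
  assumes "is_solution ts A B f y" and M: "\<And>s. norm (f s) \<le> M"
  shows "defect_le y (M * \<theta>)"
  unfolding defect_le_def
proof (intro conjI allI)
  show "continuous_on UNIV y"
    using assms(1) by (simp add: is_solution_def)
  fix n
  have "0 \<le> M"
    using M norm_ge_zero order_trans by blast
  let ?w' = "\<lambda>s. A s *v y s + B s *v y (ts n) + f s"
  have "(ts (n + 1) - ts n) * M \<le> M * \<theta>"
    using gap[of n] \<open>0 \<le> M\<close> by (simp add: mult.commute mult_left_mono)
  then show "\<exists>S w' \<beta>. finite S \<and>
        (\<forall>s\<in>{ts n<..<ts (n + 1)} - S. (y has_vector_derivative w' s) (at s) \<and>
           norm (w' s - A s *v y s - B s *v y (ts n)) \<le> \<beta> s) \<and>
        \<beta> integrable_on {ts n..ts (n + 1)} \<and> (\<forall>s\<in>{ts n..ts (n + 1)}. 0 \<le> \<beta> s) \<and>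
        integral {ts n..ts (n + 1)} \<beta> \<le> M * \<theta>"
    using is_solution_has_derivative[OF assms(1), of _ n] M \<open>0 \<le> M\<close> ts_less[of n]
    by (intro exI[of _ "{}"] exI[of _ ?w'] exI[of _ "\<lambda>_. M"]) (auto simp: integrable_const_ivl)
qed

lemma is_solution_unique:
  assumes "is_solution ts A B f y" "is_solution ts A B f z"
    and "\<And>t. norm (y t) \<le> C" "\<And>t. norm (z t) \<le> D"
  shows "y = z"
proof
  fix t
  have "is_solution ts A B (\<lambda>_. 0) (\<lambda>t. y t - z t)"
    unfolding is_solution_def
  proof (intro conjI allI impI)
    show "continuous_on UNIV (\<lambda>t. y t - z t)"
      using assms(1,2) by (auto simp: is_solution_def intro: continuous_on_diff)
    show "\<exists>d. ((\<lambda>t. y t - z t) has_vector_derivative d) (at_left (ts n))" for n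
      using assms(1,2) unfolding is_solution_def by (fast intro: has_vector_derivative_diff)
    show "\<exists>d. ((\<lambda>t. y t - z t) has_vector_derivative d) (at_right (ts n))" for n
      using assms(1,2) unfolding is_solution_def by (fast intro: has_vector_derivative_diff)
    fix s assume "s \<notin> range ts"
    then have "((\<lambda>t. y t - z t) has_vector_derivative
        ((A s *v y s + B s *v y (gamma0 ts s) + f s) - (A s *v z s + B s *v z (gamma0 ts s) + f s))) (at s)"
      using assms(1,2) unfolding is_solution_def by (intro has_vector_derivative_diff) auto
    then show "((\<lambda>t. y t - z t) has_vector_derivative
        (A s *v (y s - z s) + B s *v (y (gamma0 ts s) - z (gamma0 ts s)) + 0)) (at s)"
      by (simp add: matrix_vector_mult_diff_distrib algebra_simps)
  qed
  then have "defect_le (\<lambda>t. y t - z t) (0 * \<theta>)"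
    by (rule is_solution_defect_le) simp
  moreover have "norm (y t - z t) \<le> C + D" for t
    using assms(3,4)[of t] norm_triangle_ineq4[of "y t" "z t"] by linarith
  ultimately have "norm (y t - z t) \<le> gain * (0 * \<theta>)"
    by (rule bounded_defect_bound)
  then show "y t = z t"
    by simp
qed

lemma bounded_solution:
  assumes f: "continuous_on UNIV f" and F: "\<And>s. norm (f s) \<le> F"
  obtains y C where "is_solution ts A B f y" "\<And>t. norm (y t) \<le> C"
proof -
  have "0 \<le> F"
    using F norm_ge_zero order_trans by blast
  \<comment> \<open>The flow with zero initial value is the inhomogeneity of the difference equation
    for the values at the \<open>ts n\<close>; it has to be bounded before the Green function
    applies.\<close>
  have "norm (flow n 0 f (ts (n + 1))) \<le> F * \<theta> * exp (a * \<theta>)" for n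
  proof -
    have "norm (flow n 0 f (ts (n + 1)))
        \<le> (norm (flow n 0 f (ts n)) + F * \<theta>) * exp (a * (ts (n + 1) - ts n))"
    proof (rule gronwall_derivative[where S = "{}" and \<beta> = "\<lambda>_. F"])
      fix s assume s: "s \<in> {ts n<..<ts (n + 1)} - {}"
      then show "(flow n 0 f has_vector_derivative (A s *v flow n 0 f s + f s)) (at s)"
        using flow_has_derivative[OF f, of s n 0] by (simp add: at_within_Icc_at)
      show "norm (A s *v flow n 0 f s + f s) \<le> a * norm (flow n 0 f s) + F"
        by (rule norm_triangle_mono[OF A_mult_le F])
    next
      show "integral {ts n..ts (n + 1)} (\<lambda>_. F) \<le> F * \<theta>"
        using gap[of n] \<open>0 \<le> F\<close> ts_less[of n] by (simp add: mult.commute mult_left_mono)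
    qed (use ts_less[of n] a_nonneg \<open>0 \<le> F\<close> flow_continuous[OF f] in \<open>auto simp: integrable_const_ivl\<close>)
    also have "\<dots> \<le> F * \<theta> * exp (a * \<theta>)"
      using exp_gap_le[of "ts (n + 1)" n] ts_less[of n] \<open>0 \<le> F\<close> \<theta>_pos
      by (simp add: flow_start mult_left_mono)
    finally show ?thesis .
  qed
  then obtain \<phi> C where \<phi>: "\<And>n. norm (\<phi> n) \<le> C"
    "\<And>n. \<phi> (n + 1) = Hmat ts X B n *v \<phi> n + flow n 0 f (ts (n + 1))"
    using bounded_solution_exists[of "\<lambda>n. flow n 0 f (ts (n + 1))"] by blast
  define g where "g n u = B u *v \<phi> n + f u" for n u
  have g: "continuous_on UNIV (g n)" for n
    unfolding g_def by (intro continuous_on_add continuous_B_mult f)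
  define Y where "Y n = flow n (\<phi> n) (g n)" for n
  have Y_end: "Y n (ts (n + 1)) = \<phi> (n + 1)" for n
    using flow_add[OF continuous_B_mult f] by (simp add: Y_def g_def[abs_def] flow_end \<phi>(2))
  define y where "y t = Y (THE n. ts n \<le> t \<and> t < ts (n + 1)) t" for t
  \<comment> \<open>The right endpoint belongs to the next piece by definition of \<open>y\<close>;
    that the two pieces agree there is exactly the difference equation for \<phi>.\<close>
  have y_eq: "y t = Y n t" if "t \<in> {ts n..ts (n + 1)}" for t n
  proof (cases "t = ts (n + 1)")
    case True
    then have "(THE n. ts n \<le> t \<and> t < ts (n + 1)) = n + 1"
      using ts_less[of "n + 1"] by (intro admissible_seq_the_index seq) auto
    then show ?thesis
      using True Y_end[of n] by (simp add: y_def) (simp add: Y_def flow_start)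
  next
    case False
    then have "(THE n. ts n \<le> t \<and> t < ts (n + 1)) = n"
      using that by (intro admissible_seq_the_index seq) auto
    then show ?thesis
      by (simp add: y_def)
  qed
  have y_ts: "y (ts n) = \<phi> n" for n
    using y_eq[of "ts n" n] ts_less[of n] by (simp add: Y_def flow_start)
  have der: "(y has_vector_derivative (A t *v y t + g n t)) (at t within {ts n..ts (n + 1)})"
    if "t \<in> {ts n..ts (n + 1)}" for t n
  proof (rule has_vector_derivative_transform[OF that])
    show "(Y n has_vector_derivative (A t *v y t + g n t)) (at t within {ts n..ts (n + 1)})"
      using flow_has_derivative[OF g that, of "\<phi> n"] y_eq[OF that] by (simp add: Y_def)
  qed (rule y_eq)
  have left: "(y has_vector_derivative (A (ts n) *v y (ts n) + g (n - 1) (ts n))) (at_left (ts n))" for n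
    using der[of "ts n" "n - 1"] ts_less[of "n - 1"] by (simp add: at_within_Icc_at_left)
  have right: "(y has_vector_derivative (A (ts n) *v y (ts n) + g n (ts n))) (at_right (ts n))" for n
    using der[of "ts n" "n"] ts_less[of n] by (simp add: at_within_Icc_at_right)
  have inner: "(y has_vector_derivative (A s *v y s + B s *v y (gamma0 ts s) + f s)) (at s)"
    if s: "s \<notin> range ts" for s
  proof -
    obtain n where n: "ts n \<le> s" "s < ts (n + 1)"
      using admissible_seq_index[OF seq] .
    then have "ts n < s"
      using s by (metis order_le_less rangeI)
    then show ?thesis
      using der[of s n] n gamma0_eq[OF seq n] by (simp add: at_within_Icc_at g_def y_ts add.assoc)
  qed
  have sol: "is_solution ts A B f y"
    unfolding is_solution_def
  proof (intro conjI allI impI)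
    have "isCont y s" for s
    proof (cases "s \<in> range ts")
      case True
      then show ?thesis
        using has_vector_derivative_continuous[OF left] has_vector_derivative_continuous[OF right]
        by (auto simp: continuous_at_split)
    next
      case False
      then show ?thesis
        using has_vector_derivative_continuous[OF inner] by blast
    qed
    then show "continuous_on UNIV y"
      by (simp add: continuous_at_imp_continuous_on)
  qed (use left right inner in blast)+
  have "norm (y t) \<le> exp (a * \<theta>) * (1 + b * \<theta>) * C + exp (a * \<theta>) * (F * \<theta>)" for t
  proof -
    obtain n where n: "ts n \<le> t" "t < ts (n + 1)"
      using admissible_seq_index[OF seq] .
    have "norm (y t) \<le> exp (a * \<theta>) * (1 + b * \<theta>) * norm (y (ts n)) + exp (a * \<theta>) * (F * \<theta>)"
      using n by (intro defect_le_interval[OF is_solution_defect_le[OF sol F]]) auto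
    moreover have "exp (a * \<theta>) * (1 + b * \<theta>) * norm (y (ts n)) \<le> exp (a * \<theta>) * (1 + b * \<theta>) * C"
      using \<phi>(1)[of n] b_nonneg \<theta>_pos by (intro mult_left_mono) (auto simp: y_ts)
    ultimately show ?thesis by linarith
  qed
  then show ?thesis
    using sol that by blast
qed

section \<open>Almost periodicity of the bounded solution\<close>

lemma is_solution_lipschitz:
  assumes sol: "is_solution ts A B f y" and C: "\<And>t. norm (y t) \<le> C" and F: "\<And>s. norm (f s) \<le> F"
  shows "norm (y t - y s) \<le> (a * C + b * C + F) * \<bar>t - s\<bar>"
proof -
  have ordered: "norm (y t - y s) \<le> (a * C + b * C + F) * (t - s)" if "s \<le> t" for s t
  proof -
    have "0 \<le> C" "0 \<le> F"
      using C F norm_ge_zero order_trans by blast+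
    \<comment> \<open>Gronwall with L = 0, that is, the mean value inequality across the finitely
      many corners of \<open>y\<close>.\<close>
    have "norm (y t - y s) \<le> (norm (y s - y s) + (a * C + b * C + F) * (t - s)) * exp (0 * (t - s))"
    proof (rule gronwall_derivative[where S = "range ts \<inter> {s..t}" and b = t
          and \<beta> = "\<lambda>_. a * C + b * C + F"])
      show "continuous_on {s..t} (\<lambda>t. y t - y s)"
        using sol unfolding is_solution_def
        by (intro continuous_on_diff continuous_on_const) (blast intro: continuous_on_subset)
      show "finite (range ts \<inter> {s..t})"
        using seq by (rule finite_range_admissible_seq)
      fix r assume "r \<in> {s<..<t} - range ts \<inter> {s..t}"
      then have "r \<notin> range ts" by auto
      then have "((\<lambda>t. y t - y s) has_vector_derivative
          (A r *v y r + B r *v y (gamma0 ts r) + f r - 0)) (at r)"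
        using sol unfolding is_solution_def
        by (intro has_vector_derivative_diff has_vector_derivative_const) auto
      then show "((\<lambda>t. y t - y s) has_vector_derivative
          (A r *v y r + B r *v y (gamma0 ts r) + f r)) (at r)"
        by simp
      have "norm (A r *v y r) \<le> a * C"
        using A_mult_le[of r "y r"] C[of r] a_nonneg by (meson mult_left_mono order_trans)
      moreover have "norm (B r *v y (gamma0 ts r)) \<le> b * C"
        using B_mult_le[of r "y (gamma0 ts r)"] C b_nonneg by (meson mult_left_mono order_trans)
      ultimately show "norm (A r *v y r + B r *v y (gamma0 ts r) + f r)
          \<le> 0 * norm (y r - y s) + (a * C + b * C + F)"
        using norm_triangle_mono[OF norm_triangle_mono F] by simp
    qed (use that \<open>0 \<le> C\<close> \<open>0 \<le> F\<close> a_nonneg b_nonneg in \<open>auto simp: integrable_const_ivl mult.commute\<close>)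
    then show ?thesis by simp
  qed
  show ?thesis
    using ordered[of s t] ordered[of t s] by (cases "s \<le> t") (auto simp: norm_minus_commute)
qed

text \<open>The translate of a solution by a common almost period solves the equation up to a defect that is
  uniformly small except near the points \<open>ts n\<close>, where the argument functions may disagree; there it is
  bounded, and the exceptional set has small measure.\<close>

lemma translate_defect_le:
  assumes sol: "is_solution ts A B f y" and C: "\<And>t. norm (y t) \<le> C" and F: "\<And>s. norm (f s) \<le> F"
    and "\<eta> > 0"
    and per: "\<And>t. norm (A (t + \<tau>) - A t) \<le> \<eta>" "\<And>t. norm (B (t + \<tau>) - B t) \<le> \<eta>"
      "\<And>t. norm (f (t + \<tau>) - f t) \<le> \<eta>"
    and T: "\<And>n. \<bar>ts (n + T) - ts n - \<tau>\<bar> \<le> \<eta>"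
  shows "defect_le (\<lambda>t. y (t + \<tau>) - y t)
           (\<eta> * (\<theta> * (2 * C + 1 + b * (a * C + b * C + F)) + 4 * b * C))"
  unfolding defect_le_def
proof (intro conjI allI)
  have conty: "continuous_on UNIV y"
    using sol by (simp add: is_solution_def)
  show "continuous_on UNIV (\<lambda>t. y (t + \<tau>) - y t)"
    by (intro continuous_on_diff continuous_on_compose2[OF conty] continuous_intros conty) auto
  have "0 \<le> C" "0 \<le> F"
    using C F norm_ge_zero order_trans by blast+
  fix n
  let ?J = "{ts n..ts (n + 1)}"
  \<comment> \<open>The summand 2 * C pays for the change of \<open>A\<close> and \<open>B\<close>,
    the 1 for \<open>f\<close>, and the last one, through the Lipschitz constant of
    \<open>y\<close>, for the mismatch of \<open>ts (n + T)\<close> and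
    \<open>ts n + \<tau>\<close>.\<close>
  define \<mu> where "\<mu> = 2 * C + 1 + b * (a * C + b * C + F)"
  have "0 \<le> \<mu>"
    unfolding \<mu>_def using \<open>0 \<le> C\<close> \<open>0 \<le> F\<close> a_nonneg b_nonneg by simp
  define I where "I s = indicat_real {ts n..ts n + \<eta>} s + indicat_real {ts (n + 1) - \<eta>..ts (n + 1)} s"
    for s
  \<comment> \<open>In the two end zones only a bound by 2 * C is available for a difference of
    values of \<open>y\<close>. The zones have total length at most 2\<eta>, so after integration
    this costs 4 * b * C * \<eta>.\<close>
  define \<beta> where "\<beta> s = \<eta> * \<mu> + 2 * b * C * I s" for s
  \<comment> \<open>The times in the interval at which the translated solution meets a point of the
    sequence.\<close>
  define S where "S = (\<lambda>r. r - \<tau>) ` (range ts \<inter> {ts n + \<tau>..ts (n + 1) + \<tau>})"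
  define w' where "w' s = (A (s + \<tau>) *v y (s + \<tau>) + B (s + \<tau>) *v y (gamma0 ts (s + \<tau>)) + f (s + \<tau>))
      - (A s *v y s + B s *v y (ts n) + f s)" for s
  have "finite S"
    unfolding S_def using finite_range_admissible_seq[OF seq] by blast
  moreover have "((\<lambda>t. y (t + \<tau>) - y t) has_vector_derivative w' s) (at s)"
    and "norm (w' s - A s *v (y (s + \<tau>) - y s) - B s *v (y (ts n + \<tau>) - y (ts n))) \<le> \<beta> s"
    if s: "s \<in> {ts n<..<ts (n + 1)} - S" for s
  proof -
    have "s + \<tau> \<notin> range ts"
    proof
      assume "s + \<tau> \<in> range ts"
      then have "s + \<tau> - \<tau> \<in> S"
        unfolding S_def using s by (intro imageI) auto
      then show False
        using s by simp
    qed
    then have "(y has_vector_derivative (A (s + \<tau>) *v y (s + \<tau>) + B (s + \<tau>) *v y (gamma0 ts (s + \<tau>))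
        + f (s + \<tau>))) (at (s + \<tau>))"
      using sol unfolding is_solution_def by blast
    moreover have "((\<lambda>t. t + \<tau>) has_vector_derivative 1) (at s)"
      by (auto intro!: derivative_eq_intros)
    ultimately have "(y \<circ> (\<lambda>t. t + \<tau>) has_vector_derivative 1 *\<^sub>R (A (s + \<tau>) *v y (s + \<tau>)
        + B (s + \<tau>) *v y (gamma0 ts (s + \<tau>)) + f (s + \<tau>))) (at s)"
      by (intro vector_diff_chain_at)
    then show "((\<lambda>t. y (t + \<tau>) - y t) has_vector_derivative w' s) (at s)"
      unfolding w'_def using is_solution_has_derivative[OF sol, of s n] s
      by (intro has_vector_derivative_diff) (auto simp: o_def)
    define z where "z = y (gamma0 ts (s + \<tau>)) - y (ts n + \<tau>)"
    have z: "norm z \<le> \<eta> * (a * C + b * C + F) + 2 * C * I s"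
    proof (cases "ts n + \<eta> < s \<and> s < ts (n + 1) - \<eta>")
      case True
      \<comment> \<open>At distance more than \<eta> from both ends, \<open>s + \<tau>\<close> lies
        strictly between \<open>ts (n + T)\<close> and \<open>ts (n + 1 + T)\<close>.\<close>
      then have "gamma0 ts (s + \<tau>) = ts (n + T)"
        using T[of n] T[of "n + 1"] by (intro gamma0_eq seq) (auto simp: abs_le_iff algebra_simps)
      then have "norm z \<le> (a * C + b * C + F) * \<bar>ts (n + T) - (ts n + \<tau>)\<bar>"
        unfolding z_def using is_solution_lipschitz[OF sol C F] by simp
      also have "\<dots> \<le> (a * C + b * C + F) * \<eta>"
        using T[of n] \<open>0 \<le> C\<close> \<open>0 \<le> F\<close> a_nonneg b_nonneg by (intro mult_left_mono) (auto simp: algebra_simps)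
      also have "\<dots> \<le> \<eta> * (a * C + b * C + F) + 2 * C * I s"
        using \<open>0 \<le> C\<close> by (simp add: I_def mult.commute)
      finally show ?thesis .
    next
      case False
      then have "1 \<le> I s"
        using s by (auto simp: I_def indicator_def)
      then have "2 * C \<le> 2 * C * I s"
        using \<open>0 \<le> C\<close> by (simp add: mult_le_cancel_left1)
      moreover have "norm z \<le> 2 * C"
        unfolding z_def using norm_triangle_ineq4 C
        by (smt (verit))
      moreover have "0 \<le> \<eta> * (a * C + b * C + F)"
        using \<open>0 \<le> C\<close> \<open>0 \<le> F\<close> a_nonneg b_nonneg \<open>\<eta> > 0\<close> by simp
      ultimately show ?thesis
        by linarith
    qed
    have "w' s - A s *v (y (s + \<tau>) - y s) - B s *v (y (ts n + \<tau>) - y (ts n))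
        = ((A (s + \<tau>) - A s) *v y (s + \<tau>) + (B (s + \<tau>) - B s) *v y (gamma0 ts (s + \<tau>)))
          + (B s *v z + (f (s + \<tau>) - f s))"
      by (simp add: w'_def z_def matrix_vector_mult_diff_distrib matrix_vector_mult_diff_rdistrib)
    also have "norm \<dots> \<le> (\<eta> * C + \<eta> * C) + (b * (\<eta> * (a * C + b * C + F) + 2 * C * I s) + \<eta>)"
    proof (intro norm_triangle_mono per)
      show "norm ((A (s + \<tau>) - A s) *v y (s + \<tau>)) \<le> \<eta> * C"
        using per(1) C \<open>\<eta> > 0\<close> by (intro order_trans[OF norm_matrix_vector_mult_le] mult_mono) auto
      show "norm ((B (s + \<tau>) - B s) *v y (gamma0 ts (s + \<tau>))) \<le> \<eta> * C"
        using per(2) C \<open>\<eta> > 0\<close> by (intro order_trans[OF norm_matrix_vector_mult_le] mult_mono) auto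
      show "norm (B s *v z) \<le> b * (\<eta> * (a * C + b * C + F) + 2 * C * I s)"
        using B_mult_le[of s z] mult_left_mono[OF z b_nonneg] by linarith
    qed
    also have "\<dots> = \<beta> s"
      by (simp add: \<beta>_def \<mu>_def algebra_simps)
    finally show "norm (w' s - A s *v (y (s + \<tau>) - y s) - B s *v (y (ts n + \<tau>) - y (ts n))) \<le> \<beta> s" .
  qed
  moreover have int: "indicat_real {ts n..ts n + \<eta>} integrable_on ?J"
      "indicat_real {ts (n + 1) - \<eta>..ts (n + 1)} integrable_on ?J"
      "integral ?J (indicat_real {ts n..ts n + \<eta>}) \<le> \<eta>"
      "integral ?J (indicat_real {ts (n + 1) - \<eta>..ts (n + 1)}) \<le> \<eta>"
    using indicator_interval_integral_le[of "ts n" "ts n + \<eta>"]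
      indicator_interval_integral_le[of "ts (n + 1) - \<eta>" "ts (n + 1)"] \<open>\<eta> > 0\<close> by auto
  have I: "I integrable_on ?J"
    unfolding I_def using int(1,2) by (intro integrable_add)
  have "integral ?J I \<le> 2 * \<eta>"
    unfolding I_def using int by (subst integral_add) auto
  have cI: "(\<lambda>s. 2 * b * C * I s) integrable_on ?J"
    using integrable_on_cmult_left[OF I, of "2 * b * C"] by simp
  have "\<beta> integrable_on ?J"
    unfolding \<beta>_def by (intro integrable_add integrable_const_ivl cI)
  moreover have "0 \<le> \<beta> s" for s
    unfolding \<beta>_def I_def using \<open>0 \<le> \<mu>\<close> \<open>0 \<le> C\<close> b_nonneg \<open>\<eta> > 0\<close> by (simp add: indicator_def)
  moreover have "integral ?J \<beta> \<le> \<eta> * (\<theta> * \<mu> + 4 * b * C)"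
  proof -
    have "integral ?J \<beta> = (ts (n + 1) - ts n) * (\<eta> * \<mu>) + 2 * b * C * integral ?J I"
      unfolding \<beta>_def using ts_less[of n] cI by (subst integral_add) (auto simp: integrable_const_ivl)
    also have "\<dots> \<le> \<theta> * (\<eta> * \<mu>) + 2 * b * C * (2 * \<eta>)"
      using gap[of n] \<open>integral ?J I \<le> 2 * \<eta>\<close> \<open>0 \<le> \<mu>\<close> \<open>0 \<le> C\<close> b_nonneg \<open>\<eta> > 0\<close>
      by (intro add_mono mult_right_mono mult_left_mono) auto
    finally show ?thesis
      by (simp add: algebra_simps)
  qed
  ultimately show "\<exists>S w' \<beta>. finite S \<and>
        (\<forall>s\<in>{ts n<..<ts (n + 1)} - S. ((\<lambda>t. y (t + \<tau>) - y t) has_vector_derivative w' s) (at s) \<and>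
           norm (w' s - A s *v (y (s + \<tau>) - y s) - B s *v (y (ts n + \<tau>) - y (ts n))) \<le> \<beta> s) \<and>
        \<beta> integrable_on ?J \<and> (\<forall>s\<in>?J. 0 \<le> \<beta> s) \<and>
        integral ?J \<beta> \<le> \<eta> * (\<theta> * (2 * C + 1 + b * (a * C + b * C + F)) + 4 * b * C)"
    unfolding \<mu>_def by blast
qed

lemma bounded_solution_almost_periodic:
  assumes "H2 ts" and ap: "almost_periodic A" "almost_periodic B" "almost_periodic f"
    and sol: "is_solution ts A B f y" and C: "\<And>t. norm (y t) \<le> C"
  shows "almost_periodic y"
  unfolding almost_periodic_def
proof (intro conjI allI impI)
  show "continuous_on UNIV y"
    using sol by (simp add: is_solution_def)
  obtain F where F: "\<And>s. norm (f s) \<le> F"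
    using almost_periodic_bounded[OF ap(3)] by blast
  have "0 \<le> C" "0 \<le> F"
    using C F norm_ge_zero order_trans by blast+
  define D where "D = \<theta> * (2 * C + 1 + b * (a * C + b * C + F)) + 4 * b * C"
  have "0 \<le> D"
    unfolding D_def using \<open>0 \<le> C\<close> \<open>0 \<le> F\<close> a_nonneg b_nonneg \<theta>_pos by simp
  fix \<epsilon> :: real assume "\<epsilon> > 0"
  \<comment> \<open>Chosen so that the stability estimate turns the defect \<open>\<eta> * D\<close>
    into at most \<epsilon>; the added 1 keeps the denominator positive.\<close>
  define \<eta> where "\<eta> = \<epsilon> / (gain * D + 1)"
  have "\<eta> > 0"
    unfolding \<eta>_def using \<open>\<epsilon> > 0\<close> \<open>0 \<le> D\<close> gain_nonneg by (simp add: add_nonneg_pos)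
  have "gain * (\<eta> * D) \<le> \<eta> * (gain * D + 1)"
    using \<open>\<eta> > 0\<close> by (simp add: algebra_simps)
  also have "\<dots> = \<epsilon>"
    using \<open>0 \<le> D\<close> gain_nonneg by (simp add: \<eta>_def add_nonneg_pos less_imp_neq[symmetric])
  finally have \<eta>: "gain * (\<eta> * D) \<le> \<epsilon>" .
  define G where "G t = (A t, B t, f t)" for t
  have "almost_periodic G"
    unfolding G_def by (intro almost_periodic_Pair ap)
  then have "rel_dense {\<tau>. (\<forall>t. norm (G (t + \<tau>) - G t) \<le> \<eta>) \<and> (\<exists>T. \<forall>n. \<bar>ts (n + T) - ts n - \<tau>\<bar> \<le> \<eta>)}"
    using common_almost_periods[OF seq \<open>H2 ts\<close> _ \<open>\<eta> > 0\<close>] by blast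
  then show "rel_dense {\<tau>. \<forall>t. norm (y (t + \<tau>) - y t) \<le> \<epsilon>}"
  proof (rule rel_dense_mono, clarify)
    fix \<tau> T t
    assume G: "\<forall>t. norm (G (t + \<tau>) - G t) \<le> \<eta>" and T: "\<forall>n. \<bar>ts (n + T) - ts n - \<tau>\<bar> \<le> \<eta>"
    have "norm (A (t + \<tau>) - A t) \<le> \<eta>" "norm (B (t + \<tau>) - B t) \<le> \<eta>" "norm (f (t + \<tau>) - f t) \<le> \<eta>" for t
      using G[rule_format, of t]
        norm_fst_le[of "A (t + \<tau>) - A t" "(B (t + \<tau>) - B t, f (t + \<tau>) - f t)"]
        norm_snd_le[of "(B (t + \<tau>) - B t, f (t + \<tau>) - f t)" "A (t + \<tau>) - A t"]
        norm_fst_le[of "B (t + \<tau>) - B t" "f (t + \<tau>) - f t"]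
        norm_snd_le[of "f (t + \<tau>) - f t" "B (t + \<tau>) - B t"]
      unfolding G_def by auto
    then have "defect_le (\<lambda>t. y (t + \<tau>) - y t) (\<eta> * D)"
      unfolding D_def using T by (intro translate_defect_le[OF sol C F \<open>\<eta> > 0\<close>]) auto
    moreover have "norm (y (t + \<tau>) - y t) \<le> C + C" for t
      using C[of "t + \<tau>"] C[of t] norm_triangle_ineq4[of "y (t + \<tau>)" "y t"] by linarith
    ultimately have "norm (y (t + \<tau>) - y t) \<le> gain * (\<eta> * D)"
      by (rule bounded_defect_bound)
    then show "norm (y (t + \<tau>) - y t) \<le> \<epsilon>"
      using \<eta> by linarith
  qed
qed

end

text \<open>The estimate is asserted for every upper bound \<open>M\<close> of the norm of
  \<open>f\<close>; the least such \<open>M\<close> is the supremum norm.\<close>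

theorem theorem2:
  fixes ts :: "int \<Rightarrow> real"
    and A B X :: "real \<Rightarrow> complex^'q^'q::finite"
    and f :: "real \<Rightarrow> complex^'q"
    and Phi :: "int \<Rightarrow> complex^'q^'q"
    and P :: "complex^'q^'q"
    and K \<rho> :: real
  assumes seq: "admissible_seq ts"
    and locA: "locally_integrable A" and locB: "locally_integrable B"
    and locf: "locally_integrable f"
    and fund: "fundamental_matrix A X"
    and Jinv: "\<And>n s. s \<in> {ts n..ts (n + 1)} \<Longrightarrow> invertible (Jn ts X B n s)"
    and H1: "almost_periodic A \<and> almost_periodic B"
    and H3: "H3 ts f"
    and H6: "H6 ts X B Phi P K \<rho>"
  shows "(\<exists>!y. is_solution ts A B f y \<and> almost_periodic y) \<and>
         (\<forall>y. is_solution ts A B f y \<and> almost_periodic y \<longrightarrow>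
            (\<forall>M. (\<forall>s. norm (f s) \<le> M) \<longrightarrow>
              (let \<theta> = (SUP n. ts (n + 1) - ts n);
                   K0 = exp ((SUP s. norm (A s)) * \<theta>);
                   K3 = (sqrt (real CARD('q)) * K0 * (1 + (SUP s. norm (B s)) * \<theta>)
                          * (2 * K / (1 - \<rho>)) + 1) * sqrt (real CARD('q)) * K0 * \<theta>
               in \<forall>s. norm (y s) \<le> K3 * M)))"
proof -
  define a where "a = (SUP s. norm (A s))"
  define b where "b = (SUP s. norm (B s))"
  define \<theta> where "\<theta> = (SUP n. ts (n + 1) - ts n)"
  have "H2 ts"
    using H3 by (simp add: H3_def)
  have apA: "almost_periodic A" and apB: "almost_periodic B" and apf: "almost_periodic f"
    using H1 H3_almost_periodic[OF seq H3] by auto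
  obtain CA where CA: "\<And>s. norm (A s) \<le> CA"
    using almost_periodic_bounded[OF apA] by blast
  obtain CB where CB: "\<And>s. norm (B s) \<le> CB"
    using almost_periodic_bounded[OF apB] by blast
  obtain F where F: "\<And>s. norm (f s) \<le> F"
    using almost_periodic_bounded[OF apf] by blast
  obtain gap where gap: "\<And>n. ts (n + 1) - ts n \<le> gap"
    using H2_gap_bounded[OF \<open>H2 ts\<close>] by blast
  interpret piecewise_constant_argument ts A B X Phi P K \<rho> a b \<theta>
  proof
    show "continuous_on UNIV B"
      using apB by (simp add: almost_periodic_def)
    show "norm (A s) \<le> a" for s
      unfolding a_def by (rule cSUP_upper) (auto intro!: bdd_aboveI2[OF CA])
    show "norm (B s) \<le> b" for s
      unfolding b_def by (rule cSUP_upper) (auto intro!: bdd_aboveI2[OF CB])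
    show "ts (n + 1) - ts n \<le> \<theta>" for n
      unfolding \<theta>_def by (rule cSUP_upper[of n UNIV "\<lambda>n. ts (n + 1) - ts n"])
        (auto intro!: bdd_aboveI2[OF gap])
  qed (rule seq fund H6)+
  have "continuous_on UNIV f"
    using apf by (simp add: almost_periodic_def)
  from bounded_solution[OF this F]
  obtain y C where y: "is_solution ts A B f y" "\<And>t. norm (y t) \<le> C"
    by blast
  have "almost_periodic y"
    using bounded_solution_almost_periodic[OF \<open>H2 ts\<close> apA apB apf y] .
  moreover have "z = y" if "is_solution ts A B f z" "almost_periodic z" for z
    using almost_periodic_bounded[OF that(2)] is_solution_unique[OF that(1) y(1) _ y(2)] by blast
  ultimately have "\<exists>!y. is_solution ts A B f y \<and> almost_periodic y"
    using y(1) by blast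
  moreover
  define q where "q = sqrt (real CARD('q))"
  have "1 \<le> q"
    unfolding q_def by (simp add: Suc_leI)
  have "norm (z s) \<le> (q * exp (a * \<theta>) * (1 + b * \<theta>) * (2 * K / (1 - \<rho>)) + 1) * q * exp (a * \<theta>) * \<theta> * M"
    if sol: "is_solution ts A B f z" and ap: "almost_periodic z" and M: "\<forall>s. norm (f s) \<le> M" for z M s
  proof -
    obtain C where C: "\<And>t. norm (z t) \<le> C"
      using almost_periodic_bounded[OF ap] by blast
    have "0 \<le> M"
      using M norm_ge_zero order_trans by blast
    define k where "k = exp (a * \<theta>) * (1 + b * \<theta>) * (2 * K / (1 - \<rho>))"
    have "0 \<le> k"
      unfolding k_def using b_nonneg \<theta>_pos K_pos \<rho> by simp
    have "norm (z s) \<le> gain * (M * \<theta>)"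
      using is_solution_defect_le[OF sol] M by (intro bounded_defect_bound[OF _ C]) blast
    \<comment> \<open>The ones mark the places where the factor sqrt q, which is at least 1, is
      inserted next.\<close>
    also have "\<dots> = (1 * k + 1) * 1 * (exp (a * \<theta>) * \<theta> * M)"
      by (simp add: gain_def k_def)
    also have "\<dots> \<le> (q * k + 1) * q * (exp (a * \<theta>) * \<theta> * M)"
      using \<open>1 \<le> q\<close> \<open>0 \<le> k\<close> \<open>0 \<le> M\<close> \<theta>_pos by (intro mult_mono add_mono mult_right_mono) auto
    finally show ?thesis
      by (simp add: k_def mult_ac)
  qed
  ultimately show ?thesis
    unfolding Let_def a_def[symmetric] b_def[symmetric] \<theta>_def[symmetric] q_def[symmetric] by blast
qed

end
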